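(* Let $X$ be a finite connected $3$-regular graph and let $\mu_1(X)$ denote the second largest eigenvalue of its adjacency matrix. \begin{enumerate} \item If $\mu_1(X) \le 2$, then $X$ has at most $105$ vertices. \item If $\mu_1(X) \le 1$, then $X$ is isomorphic to one of the following six graphs: the complete graph $K_4$, the complete bipartite graph $K_{3,3}$, the triangular prism $Y_2$, the cube graph $C$, the Wagner graph $W$, or the Petersen graph $P$. \item The $3$-regular graphs with $\mu_1(X) = 1$ are exactly four: $K_{3,3}$, $C$, $W$, and $P$. \item The triangular prism $Y_2$ is the only $3$-regular graph with $\mu_1(X) = 0$. \item $K_4$ is the unique $3$-regular graph with $\mu_1(X) = -1$. \end{enumerate}
   Context: For a finite connected $k$-regular graph $X$ on $n$ vertices with adjacency matrix $A_X$, its eigenvalues (with multiplicity) are $k=\mu_0(X) \ge \mu_1(X) \ge \dots \ge \mu_{n-1}(X)$. The triangular prism $Y_2$ is the graph on $6$ vertices formed by two disjoint triangles with a perfect matching joining corresponding vertices (i.e. $K_3 \square K_2$). The cube graph $C$ is the $1$-skeleton of the $3$-dimensional cube ($8$ vertices). The Wagner graph $W$ is the graph on vertices $\mathbb{Z}/8$ in which $i$ is adjacent to $i\pm 1$ and $i+4$. The Petersen graph $P$ is the Kneser graph on the $2$-element subsets of a $5$-element set, two subsets adjacent iff disjoint.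
   Formalization: Items 3 and 4 as printed interchange two graphs: K_{3,3} has second eigenvalue 0 and the prism Y_2 has 1. The formal theorem proves that μ_1 = 1 exactly for Y_2, C, W, P, and that K_{3,3} is the only graph with μ_1 = 0. *)

theory Defs
  imports "Graph_Theory.Graph_Theory" "Jordan_Normal_Form.Char_Poly"
begin

(* Finite simple graphs are the locale predicate "graph": finite, loop-free, symmetric digraphs
   without parallel arcs.  An undirected edge is a pair of opposite arcs, so the degree of a
   vertex is its out-degree.  The library's "connected" excludes the null graph. *)

definition regular_graph :: "nat \<Rightarrow> ('a, 'b) pre_digraph \<Rightarrow> bool" where
  "regular_graph k G \<longleftrightarrow> graph G \<and> (\<forall>v \<in> verts G. out_degree G v = k)"

definition connected_cubic_graph :: "('a, 'b) pre_digraph \<Rightarrow> bool" where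
  "connected_cubic_graph G \<longleftrightarrow> regular_graph 3 G \<and> Digraph_Component.connected G"


definition adjacency_matrix_wrt :: "'a list \<Rightarrow> ('a, 'b) pre_digraph \<Rightarrow> real mat" where
  "adjacency_matrix_wrt vs G =
     Matrix.mat (length vs) (length vs) (\<lambda>(i, j). if vs ! i \<rightarrow>\<^bsub>G\<^esub> vs ! j then 1 else 0)"

(* The enumeration of the vertices is arbitrary; another one conjugates the matrix by a
   permutation matrix and leaves the characteristic polynomial unchanged. *)
definition adjacency_matrix :: "('a, 'b) pre_digraph \<Rightarrow> real mat" where
  "adjacency_matrix G =
     adjacency_matrix_wrt (SOME vs. distinct vs \<and> set vs = verts G) G"

(* All eigenvalues, repeated according to algebraic multiplicity, in decreasing order.
   The matrix is real symmetric, so no eigenvalue is lost by taking real roots only. *)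
definition graph_eigenvalues :: "('a, 'b) pre_digraph \<Rightarrow> real list" where
  "graph_eigenvalues G =
     rev (sorted_list_of_multiset (proots (char_poly (adjacency_matrix G))))"

(* Indices start at 0, so "mu 1 G" is the second largest eigenvalue. *)
definition mu :: "nat \<Rightarrow> ('a, 'b) pre_digraph \<Rightarrow> real" where
  "mu i G = graph_eigenvalues G ! i"


definition complete_graph :: "nat \<Rightarrow> nat pair_pre_digraph" where
  "complete_graph n =
     \<lparr> pverts = {..<n}, parcs = {(u, v). u < n \<and> v < n \<and> u \<noteq> v} \<rparr>"

lemma complete_digraph_complete_graph: "complete_digraph n (with_proj (complete_graph n))"
  by (auto simp: complete_digraph_pair_def complete_graph_def)

definition complete_bipartite_graph :: "nat \<Rightarrow> nat \<Rightarrow> (nat + nat) pair_pre_digraph" where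
  "complete_bipartite_graph m n =
     \<lparr> pverts = {..<m} <+> {..<n},
       parcs = Inl ` {..<m} \<times> Inr ` {..<n} \<union> Inr ` {..<n} \<times> Inl ` {..<m} \<rparr>"

lemma complete_bipartite_digraph_complete_bipartite_graph:
  "complete_bipartite_digraph m n (with_proj (complete_bipartite_graph m n))"
  unfolding complete_bipartite_digraph_pair_def
proof (intro conjI exI)
  show "pverts (complete_bipartite_graph m n) = Inl ` {..<m} \<union> Inr ` {..<n}"
    by (simp add: complete_bipartite_graph_def Plus_def)
  show "parcs (complete_bipartite_graph m n) =
      Inl ` {..<m} \<times> Inr ` {..<n} \<union> Inr ` {..<n} \<times> Inl ` {..<m}"
    by (simp add: complete_bipartite_graph_def)
  show "Inl ` {..<m} \<inter> Inr ` {..<n} = ({} :: (nat + nat) set)"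
    by blast
qed (simp_all add: complete_bipartite_graph_def card_image)

definition cartesian_product_graph ::
    "'a pair_pre_digraph \<Rightarrow> 'c pair_pre_digraph \<Rightarrow> ('a \<times> 'c) pair_pre_digraph" where
  "cartesian_product_graph G H =
     \<lparr> pverts = pverts G \<times> pverts H,
       parcs = {((a, b), (c, d)). a \<in> pverts G \<and> c \<in> pverts G \<and> b \<in> pverts H \<and> d \<in> pverts H \<and>
                  (a = c \<and> (b, d) \<in> parcs H \<or> b = d \<and> (a, c) \<in> parcs G)} \<rparr>"

definition triangular_prism :: "(nat \<times> nat) pair_pre_digraph" where
  "triangular_prism = cartesian_product_graph (complete_graph 3) (complete_graph 2)"

(* The vertices of the cube are the 0/1-vectors of length 3 (as truth values); its edges join
   vectors that differ in exactly one coordinate. *)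
definition cube_graph :: "bool list pair_pre_digraph" where
  "cube_graph =
     \<lparr> pverts = {xs. length xs = 3},
       parcs = {(xs, ys). length xs = 3 \<and> length ys = 3 \<and> card {i. i < 3 \<and> xs ! i \<noteq> ys ! i} = 1} \<rparr>"

definition wagner_graph :: "int pair_pre_digraph" where
  "wagner_graph =
     \<lparr> pverts = {0..<8},
       parcs = {(i, j). i \<in> {0..<8} \<and> j \<in> {0..<8} \<and>
                  (j = (i + 1) mod 8 \<or> j = (i - 1) mod 8 \<or> j = (i + 4) mod 8)} \<rparr>"

definition petersen_graph :: "nat set pair_pre_digraph" where
  "petersen_graph =
     \<lparr> pverts = {S. S \<subseteq> {1..5} \<and> card S = 2},
       parcs = {(S, T). S \<subseteq> {1..5} \<and> card S = 2 \<and> T \<subseteq> {1..5} \<and> card T = 2 \<and> S \<inter> T = {}} \<rparr>"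

(* Pitfall: K_{3,3} has spectrum 3, 0, 0, 0, 0, -3 and the triangular prism has spectrum
   3, 1, 0, 0, -2, -2.  So the prism belongs to the value mu 1 = 1 and K_{3,3} to mu 1 = 0.
   The printed source has these two graphs interchanged in the two lists by value, which is a
   slip; the formal statement uses the correct assignment. *)

end

theory Submission
  imports Defs "Jordan_Normal_Form.Schur_Decomposition"
begin

text \<open>
  The trace method: the sum of \<open>f(r)\<close> over the eigenvalues \<open>r\<close> of a cubic graph on \<open>n\<close> vertices
  is the trace of \<open>f(A)\<close>, a combination of numbers of closed walks. If \<open>f \<le> 0\<close> on the eigenvalues
  other than \<open>3\<close>, then the trace is at most \<open>f(3)\<close>. For \<open>\<mu>\<^sub>1 \<le> 2\<close> the choice
  \<open>f(x) = (x - 2) x\<^sup>2 (x + 2)\<^sup>2\<close> gives \<open>6 n \<le> 225\<close>, which is well below the claimed bound. For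
  \<open>\<mu>\<^sub>1 \<le> 1\<close> the choice \<open>f(x) = (x - 1) (x + 2)\<^sup>2\<close> gives \<open>5 n + 6 t \<le> 50\<close> with \<open>t\<close> the number of
  triangles, and multiplying \<open>f\<close> by \<open>x + 3\<close> excludes 4-cycles when \<open>n = 10\<close>. The few graphs
  that remain are found by hand.

  Conversely, the second eigenvalue of each of the six graphs is read off a polynomial \<open>q\<close> for
  which \<open>q(A)\<close> is a positive multiple of the all-ones matrix, together with an explicit eigenvector.
\<close>

section \<open>Real symmetric matrices\<close>

text \<open>The first polynomial is \<open>(x^2 - 4) * (x^3 + 2 * x^2)\<close>. With
  \<open>Wk\<close> for the number of closed walks of length \<open>k\<close>, its trace is
  \<open>W5 - 4 * W3\<close> plus twice \<open>W4 - 4 * W2\<close>. In a cubic graph the number of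
  walks grows at least by the factor 5 when a positive length is increased by 2, so these
  differences are at least \<open>W3\<close> and \<open>W2\<close>, and
  \<open>2 * W2 = 6 * n\<close> remains. The roots 1 and -2 of the second polynomial are the
  eigenvalues of the Petersen graph other than 3. Hence the bound is sharp at ten vertices, and this
  equality is what forbids short cycles there. At eight vertices the bound still admits one
  triangle; a single graph survives the combinatorics and has to be refuted by an explicit
  eigenvalue above 1. The six model graphs have six different vertex types, so the classification
  does not build isomorphisms directly: every graph is matched with a list of neighbour lists, a
  form in which the models can also be evaluated.\<close>

lemma proots_prod_linear_factors:
  fixes as :: "'a :: idom list"
  shows "proots (\<Prod>a\<leftarrow>as. [:- a, 1:]) = mset as"
proof (induction as)
  case (Cons a as)
  have "(\<Prod>a\<leftarrow>as. [:- a, 1:]) \<noteq> 0" by (auto simp: prod_list_zero_iff)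
  then show ?case using Cons by (simp add: proots_mult del: mult_pCons_left)
qed simp

text \<open>Over the complex numbers the polynomial splits. For an eigenvector \<open>v\<close>, the
  Hermitian form \<open>s\<close> is real by symmetry, the squared norm \<open>t\<close> is
  positive, and the eigenvalue is their quotient. So all roots are real, and the factorisation
  descends because the coefficient embedding is injective.\<close>

lemma real_symmetric_char_poly_splits:
  fixes A :: "real mat"
  assumes A: "A \<in> carrier_mat n n"
    and sym: "\<And>i j. i < n \<Longrightarrow> j < n \<Longrightarrow> A $$ (i, j) = A $$ (j, i)"
  shows "\<exists>rs. char_poly A = (\<Prod>r\<leftarrow>rs. [:- r, 1:])"
proof -
  interpret crp: map_poly_inj_comm_ring_hom complex_of_real ..
  define C where "C = map_mat complex_of_real A"
  have C: "C \<in> carrier_mat n n" using A by (simp add: C_def)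
  obtain as where as: "char_poly C = (\<Prod>a\<leftarrow>as. [:- a, 1:])"
    using char_poly_factorized[OF C] by blast
  have real: "a \<in> \<real>" if "a \<in> set as" for a
  proof -
    have "poly (char_poly C) a = 0"
      using that unfolding as poly_prod_list by (force simp: prod_list_zero_iff)
    then obtain v where v: "v \<in> carrier_vec n" "v \<noteq> 0\<^sub>v n" and ev: "C *\<^sub>v v = a \<cdot>\<^sub>v v"
      using C unfolding eigenvalue_root_char_poly[OF C, symmetric] eigenvalue_def eigenvector_def
      by auto
    define s where "s = (\<Sum>i<n. \<Sum>j<n. complex_of_real (A $$ (i, j)) * v $ j * cnj (v $ i))"
    define t where "t = (\<Sum>i<n. (cmod (v $ i))\<^sup>2)"
    have row: "(\<Sum>j<n. complex_of_real (A $$ (i, j)) * v $ j) = a * v $ i" if "i < n" for i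
    proof -
      have "(C *\<^sub>v v) $ i = (\<Sum>j<n. complex_of_real (A $$ (i, j)) * v $ j)"
        using that A v by (auto simp: C_def scalar_prod_def atLeast0LessThan)
      then show ?thesis using ev v that by simp
    qed
    have "s = (\<Sum>i<n. a * v $ i * cnj (v $ i))"
      unfolding s_def by (intro sum.cong refl) (simp add: row flip: sum_distrib_right)
    also have "\<dots> = (\<Sum>i<n. a * complex_of_real ((cmod (v $ i))\<^sup>2))"
      by (intro sum.cong refl) (simp only: complex_norm_square mult.assoc)
    also have "\<dots> = a * complex_of_real t"
      by (simp add: t_def sum_distrib_left)
    finally have s: "s = a * complex_of_real t" .
    have "cnj s = (\<Sum>i<n. \<Sum>j<n. complex_of_real (A $$ (i, j)) * cnj (v $ j) * v $ i)"
      by (simp add: s_def)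
    also have "\<dots> = (\<Sum>j<n. \<Sum>i<n. complex_of_real (A $$ (i, j)) * cnj (v $ j) * v $ i)"
      by (rule sum.swap)
    also have "\<dots> = s"
      unfolding s_def by (intro sum.cong refl) (simp add: sym mult_ac)
    finally have "s \<in> \<real>" by (simp add: Reals_cnj_iff)
    obtain i where "i < n" "v $ i \<noteq> 0" using v by (metis eq_vecI carrier_vecD index_zero_vec)
    then have "t > 0"
      unfolding t_def by (intro sum_pos2[of _ i]) auto
    then have "a = s / complex_of_real t" using s by simp
    then show ?thesis using \<open>s \<in> \<real>\<close> by simp
  qed
  define rs where "rs = map Re as"
  have "as = map complex_of_real rs"
    using real by (simp add: rs_def map_idI)
  have "char_poly C = map_poly complex_of_real (char_poly A)"
    unfolding C_def by (rule of_real_hom.char_poly_hom[OF A])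
  then have "map_poly complex_of_real (char_poly A) = (\<Prod>a\<leftarrow>as. [:- a, 1:])"
    using as by simp
  also have "\<dots> = map_poly complex_of_real (\<Prod>r\<leftarrow>rs. [:- r, 1:])"
    unfolding \<open>as = map complex_of_real rs\<close>
    by (simp add: crp.hom_prod_list o_def)
  finally show ?thesis using crp.injectivity by blast
qed

text \<open>The zeros below the diagonal belong to the claim because the induction uses them: they
  remove the terms with \<open>l < i\<close>, while triangularity of \<open>B\<close> removes those
  with \<open>l > i\<close>.\<close>

lemma diag_pow_upper_triangular:
  fixes B :: "'a :: comm_ring_1 mat"
  assumes B: "B \<in> carrier_mat n n" and tri: "upper_triangular B"
  shows "i < n \<Longrightarrow> j \<le> i \<Longrightarrow> (B ^\<^sub>m k) $$ (i, j) = (if i = j then (B $$ (i, i)) ^ k else 0)"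
proof (induction k arbitrary: i j)
  case 0
  then show ?case using B by auto
next
  case (Suc k)
  have Bk: "B ^\<^sub>m k \<in> carrier_mat n n" using B by simp
  have "(B ^\<^sub>m Suc k) $$ (i, j) = (\<Sum>l<n. (B ^\<^sub>m k) $$ (i, l) * B $$ (l, j))"
    using Suc.prems B Bk by (simp add: scalar_prod_def atLeast0LessThan)
  also have "\<dots> = (\<Sum>l<n. if l = i then (B $$ (i, i)) ^ k * B $$ (i, j) else 0)"
  proof (intro sum.cong refl)
    fix l assume "l \<in> {..<n}"
    then have l: "l < n" by simp
    consider "l < i" | "l = i" | "l > i" by linarith
    then show "(B ^\<^sub>m k) $$ (i, l) * B $$ (l, j) =
        (if l = i then (B $$ (i, i)) ^ k * B $$ (i, j) else 0)"
    proof cases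
      case 3
      then have "B $$ (l, j) = 0" using tri l Suc.prems B by auto
      then show ?thesis using 3 by simp
    qed (use Suc l in auto)
  qed
  also have "\<dots> = (B $$ (i, i)) ^ k * B $$ (i, j)" using Suc.prems by simp
  also have "\<dots> = (if i = j then (B $$ (i, i)) ^ Suc k else 0)"
    using Suc.prems upper_triangularD[OF tri, of j i] B by auto
  finally show ?case .
qed

text \<open>Schur decomposition gives a similar triangular matrix \<open>B\<close>. Similarity
  preserves the trace of each power, and the diagonal of \<open>B\<close> is \<open>rs\<close> up to
  order because the characteristic polynomials agree.\<close>

lemma trace_pow_char_poly_roots:
  fixes A :: "'a :: conjugatable_ordered_field mat"
  assumes A: "A \<in> carrier_mat n n" and cp: "char_poly A = (\<Prod>r\<leftarrow>rs. [:- r, 1:])"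
  shows "(\<Sum>i<n. (A ^\<^sub>m k) $$ (i, i)) = (\<Sum>r\<in>#mset rs. r ^ k)"
proof -
  obtain B where B: "B \<in> carrier_mat n n" "upper_triangular B" "similar_mat A B"
    using schur_decomposition_exists[OF A cp] by blast
  then obtain P Q where wit: "similar_mat_wit A B P Q" unfolding similar_mat_def by blast
  have PQ: "P \<in> carrier_mat n n" "Q \<in> carrier_mat n n" "Q * P = 1\<^sub>m n"
    using similar_mat_witD2[OF A wit] by auto
  have Bk: "B ^\<^sub>m k \<in> carrier_mat n n" and Ak: "A ^\<^sub>m k \<in> carrier_mat n n" using B A by auto
  have Ak_eq: "A ^\<^sub>m k = P * (B ^\<^sub>m k) * Q"
    using similar_mat_witD2(3)[OF Ak similar_mat_wit_pow[OF wit]] .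
  define R where "R = (B ^\<^sub>m k) * Q"
  have R: "R \<in> carrier_mat n n" using Bk PQ by (simp add: R_def)
  have "(\<Sum>i<n. (A ^\<^sub>m k) $$ (i, i)) = (\<Sum>i<n. (P * R) $$ (i, i))"
    using Ak_eq assoc_mult_mat[OF PQ(1) Bk PQ(2)] by (simp add: R_def)
  also have "\<dots> = (\<Sum>i<n. \<Sum>l<n. P $$ (i, l) * R $$ (l, i))"
    by (intro sum.cong refl) (use PQ R in \<open>simp add: scalar_prod_def atLeast0LessThan\<close>)
  also have "\<dots> = (\<Sum>l<n. \<Sum>i<n. R $$ (l, i) * P $$ (i, l))"
    by (subst sum.swap) (simp add: mult.commute)
  also have "\<dots> = (\<Sum>l<n. (R * P) $$ (l, l))"
    by (intro sum.cong refl) (use PQ R in \<open>simp add: scalar_prod_def atLeast0LessThan\<close>)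
  also have "R * P = B ^\<^sub>m k"
    using assoc_mult_mat[OF Bk PQ(2,1)] PQ(3) right_mult_one_mat[OF Bk] by (simp add: R_def)
  also have "(\<Sum>l<n. (B ^\<^sub>m k) $$ (l, l)) = (\<Sum>l<n. (B $$ (l, l)) ^ k)"
    by (intro sum.cong refl) (simp add: diag_pow_upper_triangular[OF B(1,2)])
  also have "\<dots> = (\<Sum>r\<in>#mset (diag_mat B). r ^ k)"
    using B(1) by (simp add: diag_mat_def o_def interv_sum_list_conv_sum_set_nat atLeast0LessThan
      sum_mset_sum_list flip: mset_map)
  also have "mset (diag_mat B) = proots (char_poly B)"
    by (simp add: char_poly_upper_triangular[OF B(1,2)] proots_prod_linear_factors)
  also have "\<dots> = mset rs"
    by (simp add: cp proots_prod_linear_factors flip: char_poly_similar[OF B(3)])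
  finally show ?thesis .
qed


section \<open>Closed walks and the spectrum\<close>

definition nbrs :: "('a, 'b) pre_digraph \<Rightarrow> 'a \<Rightarrow> 'a set" where
  "nbrs G u = {v. u \<rightarrow>\<^bsub>G\<^esub> v}"

text \<open>These are the entries of the powers of the adjacency matrix
  (\<open>adjacency_matrix_pow\<close>), indexed by vertices so that the arbitrary enumeration
  disappears. The values are real because they are compared with sums over eigenvalues.\<close>

primrec walks :: "('a, 'b) pre_digraph \<Rightarrow> nat \<Rightarrow> 'a \<Rightarrow> 'a \<Rightarrow> real" where
  "walks G 0 u v = of_bool (u = v)"
| "walks G (Suc k) u v = (\<Sum>z | z \<rightarrow>\<^bsub>G\<^esub> v. walks G k u z)"

declare walks.simps(2) [simp del]

definition spectrum :: "('a, 'b) pre_digraph \<Rightarrow> real multiset" where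
  "spectrum G = proots (char_poly (adjacency_matrix G))"

lemma walks_nonneg: "walks G k u v \<ge> 0"
  by (induction k arbitrary: v) (auto simp: walks.simps(2) intro: sum_nonneg)

context graph
begin

lemma nbrs_sym: "v \<in> nbrs G u \<longleftrightarrow> u \<in> nbrs G v"
  using sym_arcs by (auto simp: nbrs_def symmetric_def dest: symD)

lemma nbrs_verts: "v \<in> nbrs G u \<Longrightarrow> u \<in> verts G" "v \<in> nbrs G u \<Longrightarrow> v \<in> verts G"
  by (auto simp: nbrs_def)

lemma nbrs_irrefl: "u \<notin> nbrs G u"
  by (auto simp: nbrs_def dest: adj_not_same)

lemma finite_nbrs: "finite (nbrs G u)"
  by (rule finite_subset[of _ "verts G"]) (auto simp: nbrs_verts)

lemma in_nbrs_eq: "{z. z \<rightarrow>\<^bsub>G\<^esub> v} = nbrs G v"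
  using nbrs_sym by (auto simp: nbrs_def)

lemma walks_Suc: "walks G (Suc k) u v = (\<Sum>z\<in>nbrs G v. walks G k u z)"
  by (simp add: in_nbrs_eq walks.simps(2))


lemma out_degree_eq_card_nbrs: "out_degree G u = card (nbrs G u)"
proof -
  have "bij_betw (head G) (out_arcs G u) (nbrs G u)"
    unfolding bij_betw_def
  proof
    show "inj_on (head G) (out_arcs G u)"
      by (auto intro!: inj_onI no_multi_arcs simp: arc_to_ends_def)
    show "head G ` out_arcs G u = nbrs G u"
      by (auto simp: nbrs_def arcs_ends_def arc_to_ends_def)
  qed
  then show ?thesis unfolding out_degree_def by (rule bij_betw_same_card)
qed

lemma walks_pos_reachable:
  assumes "u \<in> verts G"
  shows "walks G k u v \<noteq> 0 \<Longrightarrow> u \<rightarrow>\<^sup>*\<^bsub>G\<^esub> v"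
proof (induction k arbitrary: v)
  case 0
  then show ?case using assms by auto
next
  case (Suc k)
  then obtain z where "z \<rightarrow>\<^bsub>G\<^esub> v" "walks G k u z \<noteq> 0"
    by (auto simp: walks.simps(2) dest: sum.not_neutral_contains_not_neutral)
  then show ?case using Suc.IH by (metis reachable_adj_trans)
qed

lemma obtain_enumeration:
  obtains vs where "distinct vs" "set vs = verts G"
    "adjacency_matrix G = adjacency_matrix_wrt vs G"
proof -
  let ?vs = "SOME vs. distinct vs \<and> set vs = verts G"
  have "distinct ?vs \<and> set ?vs = verts G"
    by (rule someI_ex) (use finite_distinct_list[OF finite_verts] in blast)
  then show ?thesis using that unfolding adjacency_matrix_def by blast
qed

lemma sum_adjacency_row:
  fixes f :: "'a \<Rightarrow> real"
  assumes vs: "distinct vs" "set vs = verts G" and i: "i < length vs"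
  shows "(\<Sum>l<length vs. f (vs ! l) * adjacency_matrix_wrt vs G $$ (l, i)) = (\<Sum>u\<in>nbrs G (vs ! i). f u)"
proof -
  have "(\<Sum>l<length vs. f (vs ! l) * adjacency_matrix_wrt vs G $$ (l, i)) =
      (\<Sum>l<length vs. f (vs ! l) * of_bool (vs ! l \<in> nbrs G (vs ! i)))"
    using i in_nbrs_eq by (intro sum.cong refl) (auto simp: adjacency_matrix_wrt_def)
  also have "\<dots> = (\<Sum>u\<in>verts G. f u * of_bool (u \<in> nbrs G (vs ! i)))"
    using vs by (intro sum.reindex_bij_betw bij_betw_nth) auto
  also have "\<dots> = (\<Sum>u\<in>nbrs G (vs ! i). f u)"
    by (intro sum.mono_neutral_cong_right) (auto simp: nbrs_verts)
  finally show ?thesis .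
qed

lemma adjacency_matrix_pow:
  assumes vs: "distinct vs" "set vs = verts G"
  shows "i < length vs \<Longrightarrow> j < length vs \<Longrightarrow>
    (adjacency_matrix_wrt vs G ^\<^sub>m k) $$ (i, j) = walks G k (vs ! i) (vs ! j)"
proof (induction k arbitrary: j)
  case 0
  then show ?case using vs by (simp add: adjacency_matrix_wrt_def nth_eq_iff_index_eq)
next
  case (Suc k)
  let ?A = "adjacency_matrix_wrt vs G"
  have A: "?A \<in> carrier_mat (length vs) (length vs)" by (simp add: adjacency_matrix_wrt_def)
  have "(?A ^\<^sub>m Suc k) $$ (i, j) = (\<Sum>l<length vs. (?A ^\<^sub>m k) $$ (i, l) * ?A $$ (l, j))"
    using Suc.prems A by (simp add: scalar_prod_def atLeast0LessThan)
  also have "\<dots> = (\<Sum>l<length vs. walks G k (vs ! i) (vs ! l) * ?A $$ (l, j))"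
    using Suc by (intro sum.cong refl) auto
  also have "\<dots> = walks G (Suc k) (vs ! i) (vs ! j)"
    by (subst sum_adjacency_row[OF vs Suc.prems(2)]) (simp add: walks_Suc)
  finally show ?case .
qed

lemma adjacency_matrix_symmetric:
  "i < length vs \<Longrightarrow> j < length vs \<Longrightarrow>
    adjacency_matrix_wrt vs G $$ (i, j) = adjacency_matrix_wrt vs G $$ (j, i)"
  using nbrs_sym by (auto simp: adjacency_matrix_wrt_def nbrs_def)

lemma sum_walks_eq_power_sum: "(\<Sum>v\<in>verts G. walks G k v v) = (\<Sum>r\<in>#spectrum G. r ^ k)"
proof -
  obtain vs where vs: "distinct vs" "set vs = verts G"
    and A: "adjacency_matrix G = adjacency_matrix_wrt vs G" by (rule obtain_enumeration)
  define n where "n = length vs"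
  have C: "adjacency_matrix G \<in> carrier_mat n n"
    unfolding A by (simp add: adjacency_matrix_wrt_def n_def)
  obtain rs where rs: "char_poly (adjacency_matrix G) = (\<Prod>r\<leftarrow>rs. [:- r, 1:])"
    using real_symmetric_char_poly_splits[OF C] adjacency_matrix_symmetric
    unfolding A n_def by blast
  have "(\<Sum>v\<in>verts G. walks G k v v) = (\<Sum>i<n. walks G k (vs ! i) (vs ! i))"
    using vs by (intro sum.reindex_bij_betw[symmetric] bij_betw_nth) (auto simp: n_def)
  also have "\<dots> = (\<Sum>i<n. (adjacency_matrix G ^\<^sub>m k) $$ (i, i))"
    unfolding A n_def by (intro sum.cong refl) (simp add: adjacency_matrix_pow[OF vs])
  also have "\<dots> = (\<Sum>r\<in>#mset rs. r ^ k)"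
    by (rule trace_pow_char_poly_roots[OF C rs])
  also have "mset rs = spectrum G"
    by (simp add: spectrum_def rs proots_prod_linear_factors)
  finally show ?thesis .
qed

lemma size_spectrum: "size (spectrum G) = card (verts G)"
  \<comment> \<open>At exponent 0 an eigenvalue 0 also counts as 1, since
    \<open>0 ^ 0 = 1\<close>.\<close>
  using sum_walks_eq_power_sum[of 0] by simp

text \<open>Replaces matrices by functions on the vertices, whose values matter only on
  \<open>verts G\<close>. It serves both to bound eigenvalues and to exhibit them.\<close>

lemma spectrum_iff_eigenvector:
  "r \<in># spectrum G \<longleftrightarrow>
    (\<exists>x. (\<exists>v\<in>verts G. x v \<noteq> 0) \<and> (\<forall>v\<in>verts G. (\<Sum>u\<in>nbrs G v. x u) = r * x v))"
    (is "_ \<longleftrightarrow> ?R")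
proof -
  obtain vs where vs: "distinct vs" "set vs = verts G"
    and A: "adjacency_matrix G = adjacency_matrix_wrt vs G" by (rule obtain_enumeration)
  define n where "n = length vs"
  have C: "adjacency_matrix G \<in> carrier_mat n n"
    unfolding A by (simp add: adjacency_matrix_wrt_def n_def)
  have "char_poly (adjacency_matrix G) \<noteq> 0"
    using degree_monic_char_poly[OF C] by auto
  then have "r \<in># spectrum G \<longleftrightarrow> eigenvalue (adjacency_matrix G) r"
    by (simp add: spectrum_def eigenvalue_root_char_poly[OF C])
  also have "\<dots> \<longleftrightarrow> ?R"
  proof -
    have mult: "(adjacency_matrix G *\<^sub>v Matrix.vec n (\<lambda>i. x (vs ! i))) $ i = (\<Sum>u\<in>nbrs G (vs ! i). x u)"
      if "i < n" for i and x :: "'a \<Rightarrow> real"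
    proof -
      have "(adjacency_matrix G *\<^sub>v Matrix.vec n (\<lambda>i. x (vs ! i))) $ i =
          (\<Sum>l<length vs. x (vs ! l) * adjacency_matrix_wrt vs G $$ (l, i))"
        using that C adjacency_matrix_symmetric[of i vs]
        by (auto simp: scalar_prod_def atLeast0LessThan n_def A mult.commute intro!: sum.cong)
      then show ?thesis using that sum_adjacency_row[OF vs] by (simp add: n_def)
    qed
    show ?thesis
    proof
      assume "eigenvalue (adjacency_matrix G) r"
      then obtain y where y: "y \<in> carrier_vec n" "y \<noteq> 0\<^sub>v n" "adjacency_matrix G *\<^sub>v y = r \<cdot>\<^sub>v y"
        using C by (auto simp: eigenvalue_def eigenvector_def)
      define x where "x v = y $ (THE i. i < n \<and> vs ! i = v)" for v
      have x: "x (vs ! i) = y $ i" if "i < n" for i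
        unfolding x_def using that vs
        by (intro arg_cong[where f = "\<lambda>j. y $ j"] the_equality) (auto simp: n_def nth_eq_iff_index_eq)
      then have yx: "y = Matrix.vec n (\<lambda>i. x (vs ! i))" using y by auto
      show ?R
      proof (intro exI[of _ x] conjI ballI)
        obtain i where "i < n" "y $ i \<noteq> 0" using y by (metis eq_vecI carrier_vecD index_zero_vec)
        then show "\<exists>v\<in>verts G. x v \<noteq> 0" using x vs by (metis n_def nth_mem)
      next
        fix v assume "v \<in> verts G"
        then obtain i where i: "i < n" "v = vs ! i" using vs by (metis n_def in_set_conv_nth)
        have "(\<Sum>u\<in>nbrs G v. x u) = (adjacency_matrix G *\<^sub>v y) $ i"
          using mult[OF i(1), of x] i yx by simp
        then show "(\<Sum>u\<in>nbrs G v. x u) = r * x v" using y i x by simp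
      qed
    next
      assume ?R
      then obtain x v where x: "v \<in> verts G" "x v \<noteq> 0" "\<forall>v\<in>verts G. (\<Sum>u\<in>nbrs G v. x u) = r * x v"
        by blast
      let ?y = "Matrix.vec n (\<lambda>i. x (vs ! i))"
      obtain i where i: "i < n" "v = vs ! i" using x vs by (metis n_def in_set_conv_nth)
      have "?y $ i \<noteq> 0\<^sub>v n $ i" using i x by simp
      then have "?y \<noteq> 0\<^sub>v n" by metis
      moreover have "adjacency_matrix G *\<^sub>v ?y = r \<cdot>\<^sub>v ?y"
        using C mult x vs by (intro eq_vecI) (auto simp: n_def)
      ultimately show "eigenvalue (adjacency_matrix G) r"
        using C by (auto simp: eigenvalue_def eigenvector_def intro!: exI[of _ ?y])
    qed
  qed
  finally show ?thesis .
qed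

text \<open>Turns the list position into the maximum of what is left after one copy of a largest
  eigenvalue is removed. \<open>M\<close> may contain \<open>a\<close> again, in which case
  \<open>mu 1 G = a\<close>. With fewer than two vertices position 1 would lie past the end of the
  list.\<close>

lemma mu_1_split:
  assumes "card (verts G) \<ge> 2"
  obtains a M where "spectrum G = add_mset a M" "mu 1 G \<in># M" "\<forall>r\<in>#M. r \<le> mu 1 G" "mu 1 G \<le> a"
proof -
  define L where "L = graph_eigenvalues G"
  have mL: "mset L = spectrum G" by (simp add: L_def graph_eigenvalues_def spectrum_def)
  have srt: "sorted (rev L)" by (simp add: L_def graph_eigenvalues_def)
  have "length L \<ge> 2" using assms size_spectrum mL by (metis size_mset)
  then obtain a b L' where L: "L = a # b # L'"
    by (cases L; cases "tl L") auto
  have "mu 1 G = b" by (simp add: mu_def flip: L_def) (simp add: L)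
  moreover have "b \<le> a" "\<forall>r\<in>set L'. r \<le> b"
    using srt unfolding L by (auto simp: sorted_append)
  ultimately show ?thesis using that[of a "mset (b # L')"] mL unfolding L by auto
qed

lemma mu_1_eqI:
  assumes "spectrum G = add_mset a M" "\<forall>r\<in>#M. r \<le> t" "t \<in># M" "t \<le> a"
  shows "mu 1 G = t"
proof -
  have "card (verts G) \<ge> 2"
    using assms size_spectrum by (cases M) auto
  then obtain b N where b: "spectrum G = add_mset b N" "mu 1 G \<in># N" "\<forall>r\<in>#N. r \<le> mu 1 G" "mu 1 G \<le> b"
    by (rule mu_1_split)
  have eq: "add_mset a M = add_mset b N" using b assms by simp
  have 1: "\<forall>r\<in>#add_mset a M. r \<le> a" using assms by force
  have 2: "\<forall>r\<in>#add_mset b N. r \<le> b" using b by force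
  have "a = b" using 1 2 eq by (metis order_antisym union_single_eq_member)
  then have "M = N" using eq by simp
  then show ?thesis using assms b by (simp add: order_antisym)
qed

text \<open>Only one of two different eigenvalues can be the removed top element; the other one is
  bounded by \<open>mu 1 G\<close>.\<close>

lemma mu_1_gt:
  assumes "r \<in># spectrum G" "s \<in># spectrum G" "r \<noteq> s" "r > t" "s > t"
  shows "mu 1 G > t"
proof -
  obtain M where M: "spectrum G = add_mset r M" using assms(1) by (metis insert_DiffM)
  then have "s \<in># M" using assms(2,3) by simp
  then have "size (spectrum G) \<ge> 2" using M by (cases M) auto
  then obtain b N where b: "spectrum G = add_mset b N" "mu 1 G \<in># N" "\<forall>r\<in>#N. r \<le> mu 1 G" "mu 1 G \<le> b"
    using size_spectrum mu_1_split by metis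
  then have "r \<in># N \<or> s \<in># N" using assms by auto
  then show ?thesis using b assms by force
qed

end


lemma (in graph) sum_spectrum_poly:
  "(\<Sum>r\<in>#spectrum G. \<Sum>k<m. c k * r ^ k) = (\<Sum>k<m. c k * (\<Sum>v\<in>verts G. walks G k v v))"
proof (induction m)
  case (Suc m)
  have "(\<Sum>r\<in>#spectrum G. c m * r ^ m) = c m * (\<Sum>v\<in>verts G. walks G m v v)"
    by (simp only: sum_walks_eq_power_sum sum_mset_distrib_left)
  then show ?case using Suc by (simp add: sum_mset.distrib)
qed simp

lemma (in graph) walks_1: "walks G (Suc 0) u v = of_bool (u \<in> nbrs G v)"
proof -
  have "(\<Sum>z\<in>nbrs G v. of_bool (u = z)) = (\<Sum>z\<in>nbrs G v. if u = z then 1 else (0::real))"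
    by (intro sum.cong) auto
  then show ?thesis using finite_nbrs by (simp add: walks_Suc)
qed

lemma (in graph) walks_2: "walks G (Suc (Suc 0)) u v = card (nbrs G u \<inter> nbrs G v)"
proof -
  have "walks G (Suc (Suc 0)) u v = (\<Sum>z\<in>nbrs G v. of_bool (z \<in> nbrs G u))"
    by (subst walks_Suc) (simp add: walks_1 nbrs_sym)
  also have "\<dots> = (\<Sum>z\<in>nbrs G u \<inter> nbrs G v. 1)"
    by (intro sum.mono_neutral_cong_right) (auto simp: finite_nbrs)
  finally show ?thesis by simp
qed

section \<open>Cubic graphs\<close>

locale cubic = graph +
  assumes card_nbrs: "v \<in> verts G \<Longrightarrow> card (nbrs G v) = 3"
    and verts_nonempty: "verts G \<noteq> {}"

context cubic
begin

lemma obtain_nbrs: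
  assumes "v \<in> verts G"
  obtains a b c where "nbrs G v = {a, b, c}" "a \<noteq> b" "a \<noteq> c" "b \<noteq> c"
  using card_nbrs[OF assms] by (auto simp: card_3_iff)

lemma card_verts_ge_4: "card (verts G) \<ge> 4"
proof -
  obtain v where v: "v \<in> verts G" using verts_nonempty by blast
  have "card (insert v (nbrs G v)) = 4"
    using card_nbrs[OF v] nbrs_irrefl finite_nbrs by simp
  moreover have "insert v (nbrs G v) \<subseteq> verts G" using v by (auto simp: nbrs_verts)
  ultimately show ?thesis by (metis card_mono finite_verts)
qed

text \<open>At a vertex \<open>w\<close> where the eigenvector is largest in absolute value, the
  three neighbours contribute at most \<open>3 * m\<close>.\<close>

lemma spectrum_bounds:
  assumes "r \<in># spectrum G" shows "\<bar>r\<bar> \<le> 3"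
proof -
  obtain x v where x: "v \<in> verts G" "x v \<noteq> 0" "\<forall>v\<in>verts G. (\<Sum>u\<in>nbrs G v. x u) = r * x v"
    using assms unfolding spectrum_iff_eigenvector by blast
  define m where "m = Max ((\<lambda>v. \<bar>x v\<bar>) ` verts G)"
  have le: "\<bar>x u\<bar> \<le> m" if "u \<in> verts G" for u
    unfolding m_def using that by (intro Max_ge) auto
  have "m \<in> (\<lambda>v. \<bar>x v\<bar>) ` verts G"
    unfolding m_def using verts_nonempty by (intro Max_in) auto
  then obtain w where w: "w \<in> verts G" "m = \<bar>x w\<bar>" by blast
  have "\<bar>r\<bar> * m = \<bar>\<Sum>u\<in>nbrs G w. x u\<bar>" using x w by (simp add: abs_mult)
  also have "\<dots> \<le> (\<Sum>u\<in>nbrs G w. \<bar>x u\<bar>)" by (rule sum_abs)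
  also have "\<dots> \<le> (\<Sum>u\<in>nbrs G w. m)" by (intro sum_mono le nbrs_verts(2))
  also have "\<dots> = 3 * m" using card_nbrs w by simp
  finally have "\<bar>r\<bar> * m \<le> 3 * m" .
  moreover have "m > 0" using le[OF x(1)] x(2) by linarith
  ultimately show ?thesis by simp
qed

lemma three_in_spectrum: "3 \<in># spectrum G"
  unfolding spectrum_iff_eigenvector
  by (rule exI[of _ "\<lambda>_. 1"]) (use verts_nonempty card_nbrs in auto)

text \<open>All eigenvalues but the top one \<open>a\<close> contribute at most 0. Bounding
  \<open>f a\<close> by \<open>f 3\<close> through the third assumption spares the identification of
  \<open>a\<close> with 3.\<close>

lemma sum_spectrum_le:
  fixes f :: "real \<Rightarrow> real"
  assumes "mu 1 G \<le> t"
    and "\<And>r. -3 \<le> r \<Longrightarrow> r \<le> t \<Longrightarrow> f r \<le> 0"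
    and "\<And>r. -3 \<le> r \<Longrightarrow> r \<le> 3 \<Longrightarrow> f r \<le> f 3"
  shows "(\<Sum>r\<in>#spectrum G. f r) \<le> f 3"
proof -
  obtain a M where M: "spectrum G = add_mset a M" "mu 1 G \<in># M" "\<forall>r\<in>#M. r \<le> mu 1 G" "mu 1 G \<le> a"
    using card_verts_ge_4 by (elim mu_1_split[rotated]) auto
  have "f r \<le> 0" if "r \<in># M" for r
    using that assms M spectrum_bounds[of r] by force
  then have "(\<Sum>r\<in>#M. f r) \<le> (\<Sum>r\<in>#M. 0)"
    by (intro sum_mset_mono)
  moreover have "f a \<le> f 3" using assms(3)[of a] spectrum_bounds[of a] M by auto
  ultimately show ?thesis using M by simp
qed

lemma walks_2_self: "v \<in> verts G \<Longrightarrow> walks G (Suc (Suc 0)) v v = 3"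
  by (simp add: walks_2 card_nbrs)

lemma walks_2_ge_1:
  assumes "u \<in> nbrs G z" "v \<in> nbrs G z"
  shows "walks G (Suc (Suc 0)) u v \<ge> 1"
proof -
  have "z \<in> nbrs G u \<inter> nbrs G v" using assms nbrs_sym by blast
  then have "card (nbrs G u \<inter> nbrs G v) \<noteq> 0" using finite_nbrs by auto
  then show ?thesis by (simp add: walks_2)
qed

text \<open>Classify the walks by the vertex \<open>z\<close> from which they enter
  \<open>v\<close>. For \<open>z = u\<close> there are three closed walks of length 2 at
  \<open>u\<close>; for each of the two other neighbours there is at least the walk through
  \<open>v\<close> itself. This gives 3 + 1 + 1.\<close>

lemma walks_3_ge:
  assumes "u \<in> nbrs G v" shows "walks G (Suc (Suc (Suc 0))) u v \<ge> 5"
proof -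
  have v: "v \<in> verts G" and u: "u \<in> verts G" using assms nbrs_verts by auto
  have "walks G (Suc (Suc (Suc 0))) u v =
      walks G (Suc (Suc 0)) u u + (\<Sum>z\<in>nbrs G v - {u}. walks G (Suc (Suc 0)) u z)"
    using assms finite_nbrs by (subst walks_Suc) (simp add: sum.remove)
  moreover have "(\<Sum>z\<in>nbrs G v - {u}. walks G (Suc (Suc 0)) u z) \<ge> (\<Sum>z\<in>nbrs G v - {u}. 1)"
    using assms by (intro sum_mono walks_2_ge_1) auto
  moreover have "card (nbrs G v - {u}) = 2"
    using assms card_nbrs[OF v] finite_nbrs by simp
  ultimately show ?thesis using walks_2_self[OF u] by simp
qed

text \<open>The shorter length starts at 1 because the factor 5 fails at length 0: a vertex has only
  three closed walks of length 2.\<close>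

lemma walks_add_2_ge: "walks G (Suc (Suc (Suc k))) u v \<ge> 5 * walks G (Suc k) u v"
proof (induction k arbitrary: v)
  case 0
  show ?case using walks_3_ge walks_nonneg by (cases "u \<in> nbrs G v") (auto simp: walks_1)
next
  case (Suc k)
  have "5 * walks G (Suc (Suc k)) u v = (\<Sum>z\<in>nbrs G v. 5 * walks G (Suc k) u z)"
    by (subst walks_Suc) (simp add: sum_distrib_left)
  also have "\<dots> \<le> (\<Sum>z\<in>nbrs G v. walks G (Suc (Suc (Suc k))) u z)"
    by (intro sum_mono Suc.IH)
  also have "\<dots> = walks G (Suc (Suc (Suc (Suc k)))) u v"
    by (rule walks_Suc[symmetric])
  finally show ?case .
qed

section \<open>Trace inequalities from test polynomials\<close>

abbreviation closed_walks :: "nat \<Rightarrow> real" where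
  "closed_walks k \<equiv> \<Sum>v\<in>verts G. walks G k v v"

lemma closed_walks_1: "closed_walks (Suc 0) = 0"
  by (simp add: walks_1 nbrs_irrefl)

lemma closed_walks_2: "closed_walks (Suc (Suc 0)) = 3 * card (verts G)"
  by (simp add: walks_2_self)

lemma closed_walks_add_2_ge: "closed_walks (Suc (Suc (Suc k))) \<ge> 5 * closed_walks (Suc k)"
  unfolding sum_distrib_left by (intro sum_mono walks_add_2_ge)

lemma closed_walks_3_nonneg: "closed_walks (Suc (Suc (Suc 0))) \<ge> 0"
  by (intro sum_nonneg walks_nonneg)

lemma card_le_37:
  assumes "mu 1 G \<le> 2" shows "card (verts G) \<le> 37"
proof -
  define f :: "real \<Rightarrow> real" where "f r = (r - 2) * r\<^sup>2 * (r + 2)\<^sup>2" for r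
  define c where "c = (!) [0, 0, -8, -4, 2, 1 :: real]"
  have "f r = (\<Sum>k<6. c k * r ^ k)" for r
    by (simp add: f_def c_def eval_nat_numeral lessThan_Suc algebra_simps)
  then have "(\<Sum>r\<in>#spectrum G. f r) = (\<Sum>k<6. c k * closed_walks k)"
    by (simp only: sum_spectrum_poly)
  also have "\<dots> = closed_walks 5 + 2 * closed_walks 4 - 4 * closed_walks 3 - 8 * closed_walks 2"
    by (simp add: c_def eval_nat_numeral lessThan_Suc)
  also have "\<dots> \<ge> 6 * card (verts G)"
    using closed_walks_add_2_ge[of 2] closed_walks_add_2_ge[of 1] closed_walks_2 closed_walks_3_nonneg
    by (simp add: eval_nat_numeral)
  finally have "6 * card (verts G) \<le> (\<Sum>r\<in>#spectrum G. f r)" .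
  also have "\<dots> \<le> f 3"
  proof (rule sum_spectrum_le[OF assms])
    fix r :: real
    \<comment> \<open>The other factors are squares, so the sign is that of
      \<open>r - 2\<close>.\<close>
    show le: "f r \<le> 0" if "r \<le> 2"
      using that by (simp add: f_def mult_nonpos_nonneg)
    show "f r \<le> f 3" if "r \<le> 3"
    proof (cases "r \<le> 2")
      case False
      then show ?thesis unfolding f_def using that by (intro mult_mono power_mono) auto
    qed (use le in \<open>simp add: f_def\<close>)
  qed
  finally show ?thesis by (simp add: f_def)
qed

text \<open>Expanding gives \<open>f r = r^3 + 3 * r^2 - 4\<close>. Besides at most ten vertices,
  the inequality yields no closed walk of length 3 at ten vertices and at most 10 of them, hence at
  most one triangle, at eight.\<close>

lemma closed_walks_3_le:
  assumes "mu 1 G \<le> 1"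
  shows "5 * card (verts G) + closed_walks (Suc (Suc (Suc 0))) \<le> 50"
proof -
  define f :: "real \<Rightarrow> real" where "f r = (r - 1) * (r + 2)\<^sup>2" for r
  define c where "c = (!) [-4, 0, 3, 1 :: real]"
  have "f r = (\<Sum>k<4. c k * r ^ k)" for r
    by (simp add: f_def c_def eval_nat_numeral lessThan_Suc algebra_simps)
  then have "(\<Sum>r\<in>#spectrum G. f r) = (\<Sum>k<4. c k * closed_walks k)"
    by (simp only: sum_spectrum_poly)
  also have "\<dots> = 5 * card (verts G) + closed_walks (Suc (Suc (Suc 0)))"
    using closed_walks_1 closed_walks_2 by (simp add: c_def eval_nat_numeral lessThan_Suc)
  finally have "5 * card (verts G) + closed_walks (Suc (Suc (Suc 0))) = (\<Sum>r\<in>#spectrum G. f r)" ..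
  also have "\<dots> \<le> f 3"
  proof (rule sum_spectrum_le[OF assms])
    fix r :: real
    show le: "f r \<le> 0" if "r \<le> 1"
      using that by (simp add: f_def mult_nonpos_nonneg)
    show "f r \<le> f 3" if "r \<le> 3"
    proof (cases "r \<le> 1")
      case False
      then show ?thesis unfolding f_def using that by (intro mult_mono power_mono) auto
    qed (use le in \<open>simp add: f_def\<close>)
  qed
  finally show ?thesis by (simp add: f_def)
qed

text \<open>The extra factor \<open>r + 3\<close> is nonnegative on the spectrum and keeps the
  signs. At ten vertices the result is an upper bound 150 on the closed walks of length 4, which
  equals the lower bound 15 per vertex.\<close>

lemma closed_walks_4_le:
  assumes "mu 1 G \<le> 1"
  shows "closed_walks (Suc (Suc (Suc (Suc 0)))) + 6 * closed_walks (Suc (Suc (Suc 0)))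
    + 15 * card (verts G) \<le> 300"
proof -
  define f :: "real \<Rightarrow> real" where "f r = (r - 1) * (r + 2)\<^sup>2 * (r + 3)" for r
  define c where "c = (!) [-12, -4, 9, 6, 1 :: real]"
  have "f r = (\<Sum>k<5. c k * r ^ k)" for r
    by (simp add: f_def c_def eval_nat_numeral lessThan_Suc algebra_simps)
  then have "(\<Sum>r\<in>#spectrum G. f r) = (\<Sum>k<5. c k * closed_walks k)"
    by (simp only: sum_spectrum_poly)
  also have "\<dots> = closed_walks (Suc (Suc (Suc (Suc 0)))) + 6 * closed_walks (Suc (Suc (Suc 0)))
      + 15 * card (verts G)"
    using closed_walks_1 closed_walks_2 by (simp add: c_def eval_nat_numeral lessThan_Suc)
  finally have "closed_walks (Suc (Suc (Suc (Suc 0)))) + 6 * closed_walks (Suc (Suc (Suc 0)))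
      + 15 * card (verts G) = (\<Sum>r\<in>#spectrum G. f r)" ..
  also have "\<dots> \<le> f 3"
  proof (rule sum_spectrum_le[OF assms])
    fix r :: real
    assume "-3 \<le> r"
    then show le: "f r \<le> 0" if "r \<le> 1"
      using that by (simp add: f_def mult_nonpos_nonneg)
    show "f r \<le> f 3" if "r \<le> 3"
    proof (cases "r \<le> 1")
      case False
      then show ?thesis unfolding f_def using that by (intro mult_mono power_mono) auto
    qed (use le in \<open>simp add: f_def\<close>)
  qed
  finally show ?thesis by (simp add: f_def)
qed

end


section \<open>Labellings and Hoffman polynomials\<close>

definition adjacency_list :: "nat list list \<Rightarrow> bool" where
  "adjacency_list nb \<longleftrightarrow>
    (\<forall>ls\<in>set nb. distinct ls \<and> length ls = 3 \<and> (\<forall>l\<in>set ls. l < length nb))"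

text \<open>\<open>nb\<close> fixes the isomorphism type independently of the vertex type and is
  concrete enough for evaluation, so it mediates between an abstract graph and its model.\<close>

definition labelling :: "('a, 'b) pre_digraph \<Rightarrow> nat list list \<Rightarrow> 'a list \<Rightarrow> bool" where
  "labelling G nb vs \<longleftrightarrow> adjacency_list nb \<and> distinct vs \<and> set vs = verts G \<and> length vs = length nb \<and>
    (\<forall>i<length nb. nbrs G (vs ! i) = (!) vs ` set (nb ! i))"

text \<open>An isomorphism renames the arcs and replaces the head and tail maps too, so simplicity
  and symmetry have to be carried over explicitly.\<close>

lemma (in graph) graph_app_iso:
  assumes phi: "digraph_isomorphism phi"
  shows "graph (app_iso phi G)"
proof -
  interpret H: fin_digraph "app_iso phi G" using phi by (rule fin_digraphI_app_iso)
  note ends = iso_verts_head[OF phi] iso_verts_tail[OF phi]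
  show ?thesis
  proof
    fix e assume "e \<in> arcs (app_iso phi G)"
    then show "tail (app_iso phi G) e \<noteq> head (app_iso phi G) e"
      using phi no_loops by (auto simp: ends)
  next
    fix e1 e2
    assume "e1 \<in> arcs (app_iso phi G)" "e2 \<in> arcs (app_iso phi G)"
      "arc_to_ends (app_iso phi G) e1 = arc_to_ends (app_iso phi G) e2"
    then show "e1 = e2"
      using phi by (auto simp: arc_to_ends_def ends intro!: arg_cong[of _ _ "iso_arcs phi"] no_multi_arcs)
  next
    show "symmetric (app_iso phi G)"
      using sym_arcs unfolding symmetric_def arcs_ends_app_iso_eq[OF phi]
      by (force simp: sym_def)
  qed
qed

lemma (in wf_digraph) nbrs_app_iso:
  assumes phi: "digraph_isomorphism phi" and u: "u \<in> verts G"
  shows "nbrs (app_iso phi G) (iso_verts phi u) = iso_verts phi ` nbrs G u"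
  unfolding nbrs_def arcs_ends_app_iso_eq[OF phi]
  using u adj_in_verts iso_verts_eq_iff[OF phi] by (force simp: image_iff)

lemma labelling_lt: "labelling G nb vs \<Longrightarrow> i < length nb \<Longrightarrow> l \<in> set (nb ! i) \<Longrightarrow> l < length nb"
  by (auto simp: labelling_def adjacency_list_def)

lemma labelling_nth_eq:
  "labelling G nb vs \<Longrightarrow> i < length nb \<Longrightarrow> j < length nb \<Longrightarrow> vs ! i = vs ! j \<longleftrightarrow> i = j"
  by (simp add: labelling_def nth_eq_iff_index_eq)

lemma labelling_nth_in_verts: "labelling G nb vs \<Longrightarrow> i < length nb \<Longrightarrow> vs ! i \<in> verts G"
  by (metis labelling_def nth_mem)

lemma labelling_obtain_index:
  assumes "labelling G nb vs" "v \<in> verts G"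
  obtains i where "i < length nb" "v = vs ! i"
  using assms unfolding labelling_def by (metis in_set_conv_nth)

lemma labelling_adjacent_iff:
  assumes "labelling G nb vs" "i < length nb" "j < length nb"
  shows "vs ! i \<rightarrow>\<^bsub>G\<^esub> vs ! j \<longleftrightarrow> j \<in> set (nb ! i)"
proof -
  have "vs ! i \<rightarrow>\<^bsub>G\<^esub> vs ! j \<longleftrightarrow> vs ! j \<in> (!) vs ` set (nb ! i)"
    using assms by (simp add: labelling_def nbrs_def set_eq_iff)
  also have "\<dots> \<longleftrightarrow> j \<in> set (nb ! i)"
    using assms labelling_lt[OF assms(1,2)] labelling_nth_eq[OF assms(1) _ assms(3)] by force
  finally show ?thesis .
qed

lemma (in wf_digraph) labelling_app_iso:
  assumes phi: "digraph_isomorphism phi" and lab: "labelling G nb vs"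
  shows "labelling (app_iso phi G) nb (map (iso_verts phi) vs)"
proof -
  have len: "length vs = length nb" and vs: "set vs = verts G"
    using lab by (auto simp: labelling_def)
  have "inj_on (iso_verts phi) (set vs)"
    using phi lab by (simp add: digraph_isomorphism_def labelling_def)
  moreover have "nbrs (app_iso phi G) (map (iso_verts phi) vs ! i) =
      (!) (map (iso_verts phi) vs) ` set (nb ! i)" if i: "i < length nb" for i
  proof -
    have "nbrs (app_iso phi G) (map (iso_verts phi) vs ! i) = iso_verts phi ` nbrs G (vs ! i)"
      using nbrs_app_iso[OF phi labelling_nth_in_verts[OF lab i]] i len by simp
    also have "\<dots> = (\<lambda>l. iso_verts phi (vs ! l)) ` set (nb ! i)"
      using lab i by (simp add: labelling_def image_image)
    also have "\<dots> = (!) (map (iso_verts phi) vs) ` set (nb ! i)"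
      using labelling_lt[OF lab i] len by (intro image_cong) auto
    finally show ?thesis .
  qed
  ultimately show ?thesis
    using lab by (simp add: labelling_def distinct_map)
qed

lemma digraph_iso_imp_labelling:
  assumes iso: "digraph_iso G H" and H: "graph H" and lab: "labelling H nb ws"
  shows "graph G \<and> (\<exists>vs. labelling G nb vs)"
proof -
  have "wf_digraph G"
    using iso by (auto simp: digraph_iso_def pre_digraph.digraph_isomorphism_def)
  then have "digraph_iso H G" using iso by (rule digraph_iso_swap)
  then obtain phi where phi: "pre_digraph.digraph_isomorphism H phi" "G = app_iso phi H"
    by (auto simp: digraph_iso_def)
  interpret H: graph H by fact
  show ?thesis
    using H.graph_app_iso[OF phi(1)] H.labelling_app_iso[OF phi(1) lab] phi(2) by blast
qed

text \<open>Vertices with equal index correspond. Arcs of \<open>with_proj H\<close> are pairs, so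
  an arc of \<open>G\<close> must go to the pair of images of its ends; this is injective because
  \<open>G\<close> has no parallel arcs.\<close>

lemma labelling_imp_digraph_iso:
  assumes G: "graph G" and labG: "labelling G nb vs" and labH: "labelling (with_proj H) nb ws"
    and H: "graph (with_proj H)"
  shows "digraph_iso G (with_proj H)"
proof -
  interpret G: graph G by fact
  interpret H: graph "with_proj H" by fact
  define f where "f v = ws ! (THE i. i < length nb \<and> vs ! i = v)" for v
  have f: "f (vs ! i) = ws ! i" if "i < length nb" for i
    unfolding f_def using that labelling_nth_eq[OF labG]
    by (intro arg_cong[where f = "(!) ws"] the_equality) auto
  have inj: "inj_on f (verts G)"
  proof (rule inj_onI)
    fix u v assume "u \<in> verts G" "v \<in> verts G" "f u = f v"
    then show "u = v"
      using labelling_nth_eq[OF labH] by (elim labelling_obtain_index[OF labG]) (simp add: f)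
  qed
  have adj: "(f u, f v) \<in> parcs H \<longleftrightarrow> u \<rightarrow>\<^bsub>G\<^esub> v" if "u \<in> verts G" "v \<in> verts G" for u v
    using that labelling_adjacent_iff[OF labG] labelling_adjacent_iff[OF labH]
    by (elim labelling_obtain_index[OF labG]) (simp add: f)
  have img: "f ` verts G = pverts H"
  proof -
    have "(!) vs ` {..<length nb} = verts G" "(!) ws ` {..<length nb} = pverts H"
      using labG labH by (auto simp: labelling_def nth_image simp flip: atLeast0LessThan)
    then show ?thesis by (metis (no_types, lifting) f image_cong image_image lessThan_iff)
  qed
  define phi where "phi = \<lparr>iso_verts = f, iso_arcs = \<lambda>a. (f (tail G a), f (head G a)),
    iso_head = snd, iso_tail = fst\<rparr>"
  have "G.digraph_isomorphism phi"
    unfolding G.digraph_isomorphism_def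
  proof (intro conjI G.wf_digraph)
    show "inj_on (iso_arcs phi) (arcs G)"
    proof (rule inj_onI)
      fix a b assume ab: "a \<in> arcs G" "b \<in> arcs G" "iso_arcs phi a = iso_arcs phi b"
      then have "f (tail G a) = f (tail G b)" "f (head G a) = f (head G b)"
        by (simp_all add: phi_def)
      then have "tail G a = tail G b" "head G a = head G b"
        using ab inj by (meson G.tail_in_verts G.head_in_verts inj_onD)+
      then show "a = b" using ab by (intro G.no_multi_arcs) (auto simp: arc_to_ends_def)
    qed
  qed (simp_all add: phi_def inj)
  moreover have "(\<lambda>a. (f (tail G a), f (head G a))) ` arcs G = parcs H"
  proof (intro equalityI subsetI)
    fix e assume "e \<in> (\<lambda>a. (f (tail G a), f (head G a))) ` arcs G"
    then show "e \<in> parcs H" using adj by (auto intro: G.in_arcs_imp_in_arcs_ends)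
  next
    fix e assume e: "e \<in> parcs H"
    then have "fst e \<in> pverts H" "snd e \<in> pverts H"
      using H.adj_in_verts[of "fst e" "snd e"] by auto
    then obtain u v where uv: "u \<in> verts G" "v \<in> verts G" "e = (f u, f v)"
      using img by (metis imageE prod.collapse)
    then have "u \<rightarrow>\<^bsub>G\<^esub> v" using adj e by simp
    then obtain a where "a \<in> arcs G" "tail G a = u" "head G a = v" by (auto simp: arcs_ends_conv)
    then show "e \<in> (\<lambda>a. (f (tail G a), f (head G a))) ` arcs G" using uv by force
  qed
  then have "with_proj H = app_iso phi G"
    by (simp add: app_iso_def with_proj_def phi_def img)
  ultimately show ?thesis by (auto simp: digraph_iso_def)
qed

text \<open>Horner evaluation of row \<open>i\<close> of \<open>q(A)\<close>, coefficients in
  ascending order: \<open>w\<close> is the row for the remaining coefficients, and summing it over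
  neighbour lists multiplies it by \<open>A\<close>. Integer entries make it executable.\<close>

primrec matrix_poly_row :: "nat list list \<Rightarrow> nat \<Rightarrow> int list \<Rightarrow> int list" where
  "matrix_poly_row nb i [] = replicate (length nb) 0"
| "matrix_poly_row nb i (q # qs) = (let w = matrix_poly_row nb i qs in
    map (\<lambda>(j, ls). (if i = j then q else 0) + (\<Sum>l\<leftarrow>ls. w ! l)) (zip [0..<length nb] nb))"

lemma (in graph) sum_nbrs_labelling:
  fixes x :: "'a \<Rightarrow> real"
  assumes lab: "labelling G nb vs" and j: "j < length nb"
  shows "(\<Sum>u\<in>nbrs G (vs ! j). x u) = (\<Sum>l\<leftarrow>nb ! j. x (vs ! l))"
proof -
  have d: "distinct (nb ! j)" using lab j by (simp add: labelling_def adjacency_list_def)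
  have "inj_on ((!) vs) (set (nb ! j))"
    using labelling_nth_eq[OF lab] labelling_lt[OF lab j] by (auto intro!: inj_onI)
  then have "(\<Sum>u\<in>nbrs G (vs ! j). x u) = (\<Sum>l\<in>set (nb ! j). x (vs ! l))"
    using lab j by (simp add: labelling_def sum.reindex)
  then show ?thesis using d by (simp add: sum_list_distinct_conv_sum_set)
qed

lemma (in graph) matrix_poly_row:
  assumes lab: "labelling G nb vs" and i: "i < length nb"
  shows "j < length nb \<Longrightarrow> (\<Sum>k<length qs. of_int (qs ! k) * walks G k (vs ! i) (vs ! j)) =
    of_int (matrix_poly_row nb i qs ! j)"
proof (induction qs arbitrary: j)
  case (Cons q qs)
  have "(\<Sum>k<length (q # qs). of_int ((q # qs) ! k) * walks G k (vs ! i) (vs ! j)) =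
      of_int q * of_bool (i = j) +
      (\<Sum>k<length qs. \<Sum>z\<in>nbrs G (vs ! j). of_int (qs ! k) * walks G k (vs ! i) z)"
    using labelling_nth_eq[OF lab i Cons.prems]
    by (simp add: sum.lessThan_Suc_shift walks_Suc sum_distrib_left del: sum.lessThan_Suc)
  also have "(\<Sum>k<length qs. \<Sum>z\<in>nbrs G (vs ! j). of_int (qs ! k) * walks G k (vs ! i) z) =
      (\<Sum>l\<leftarrow>nb ! j. of_int (matrix_poly_row nb i qs ! l))"
  proof -
    have "(\<Sum>k<length qs. \<Sum>z\<in>nbrs G (vs ! j). of_int (qs ! k) * walks G k (vs ! i) z) =
        (\<Sum>z\<in>nbrs G (vs ! j). \<Sum>k<length qs. of_int (qs ! k) * walks G k (vs ! i) z)"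
      by (rule sum.swap)
    also have "\<dots> = (\<Sum>l\<leftarrow>nb ! j. \<Sum>k<length qs. of_int (qs ! k) * walks G k (vs ! i) (vs ! l))"
      by (rule sum_nbrs_labelling[OF lab Cons.prems])
    also have "\<dots> = (\<Sum>l\<leftarrow>nb ! j. of_int (matrix_poly_row nb i qs ! l))"
      using Cons.IH labelling_lt[OF lab Cons.prems] by (intro arg_cong[where f = sum_list] map_cong) auto
    finally show ?thesis .
  qed
  also have "of_int q * of_bool (i = j) + \<dots> = of_int (matrix_poly_row nb i (q # qs) ! j)"
    using Cons.prems by (simp add: Let_def of_int_hom.hom_sum_list o_def)
  finally show ?case .
qed simp

lemma (in graph) sum_verts_nbrs_swap:
  fixes h :: "'a \<Rightarrow> 'a \<Rightarrow> real"
  shows "(\<Sum>v\<in>verts G. \<Sum>z\<in>nbrs G v. h z v) = (\<Sum>z\<in>verts G. \<Sum>v\<in>nbrs G z. h z v)"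
proof -
  have "(\<Sum>v\<in>verts G. \<Sum>z\<in>nbrs G v. h z v) = (\<Sum>v\<in>verts G. \<Sum>z\<in>verts G. if z \<in> nbrs G v then h z v else 0)"
    by (intro sum.cong refl sum.mono_neutral_cong_left) (auto simp: nbrs_verts)
  also have "\<dots> = (\<Sum>z\<in>verts G. \<Sum>v\<in>verts G. if v \<in> nbrs G z then h z v else 0)"
    by (subst sum.swap) (intro sum.cong refl if_cong nbrs_sym)
  also have "\<dots> = (\<Sum>z\<in>verts G. \<Sum>v\<in>nbrs G z. h z v)"
    by (intro sum.cong refl sum.mono_neutral_cong_right) (auto simp: nbrs_verts)
  finally show ?thesis .
qed

lemma (in graph) walks_eigenvector:
  assumes x: "\<forall>v\<in>verts G. (\<Sum>u\<in>nbrs G v. x u) = r * x v" and u: "u \<in> verts G"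
  shows "(\<Sum>v\<in>verts G. walks G k u v * x v) = r ^ k * x u"
proof (induction k)
  case 0
  have "(\<Sum>v\<in>verts G. walks G 0 u v * x v) = (\<Sum>v\<in>verts G. if u = v then x v else 0)"
    by (intro sum.cong refl) simp
  then show ?case using u by simp
next
  case (Suc k)
  have "(\<Sum>v\<in>verts G. walks G (Suc k) u v * x v) = (\<Sum>v\<in>verts G. \<Sum>z\<in>nbrs G v. walks G k u z * x v)"
    by (simp add: walks_Suc sum_distrib_right)
  also have "\<dots> = (\<Sum>z\<in>verts G. walks G k u z * (\<Sum>v\<in>nbrs G z. x v))"
    by (subst sum_verts_nbrs_swap) (simp add: sum_distrib_left)
  also have "\<dots> = r * (\<Sum>z\<in>verts G. walks G k u z * x z)"
    using x by (simp add: sum_distrib_left mult_ac)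
  finally show ?case using Suc by simp
qed

text \<open>A polynomial \<open>q\<close> with \<open>q(A)\<close> a nonzero multiple of the all-ones matrix
  (a Hoffman polynomial) exhibits connectivity, vanishes on all eigenvalues other than \<open>3\<close>,
  and, through the trace of \<open>q(A)\<close>, shows that the eigenvalue \<open>3\<close> is simple.\<close>

lemma (in cubic) hoffman_polynomial:
  fixes q :: "nat \<Rightarrow> real"
  assumes c: "c > 0"
    and hoff: "\<And>u v. u \<in> verts G \<Longrightarrow> v \<in> verts G \<Longrightarrow> (\<Sum>k<m. q k * walks G k u v) = c"
  shows "connected G"
    and "\<exists>M. spectrum G = add_mset 3 M \<and> (\<forall>r\<in>#M. r \<noteq> 3 \<and> (\<Sum>k<m. q k * r ^ k) = 0)"
proof -
  have "u \<rightarrow>\<^sup>*\<^bsub>G\<^esub> v" if uv: "u \<in> verts G" "v \<in> verts G" for u v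
  proof -
    have "(\<Sum>k<m. q k * walks G k u v) \<noteq> 0" using hoff[OF uv] c by simp
    then obtain k where "walks G k u v \<noteq> 0"
      by (metis (no_types, lifting) mult_zero_right sum.neutral)
    then show ?thesis using walks_pos_reachable uv by blast
  qed
  then have "strongly_connected G"
    using verts_nonempty by (simp add: strongly_connected_def)
  then show "connected G"
    by (auto simp: connected_def strongly_connected_def intro: reachable_mk_symmetricI)
  define p where "p r = (\<Sum>k<m. q k * r ^ k)" for r
  define n where "n = real (card (verts G))"
  have n: "n > 0" using card_verts_ge_4 by (simp add: n_def)
  \<comment> \<open>On an eigenvector, \<open>q(A)\<close> acts as the scalar \<open>p r\<close>; as
    a multiple of the all-ones matrix it turns every entry into \<open>c\<close> times the
    total.\<close>
  have p_eig: "p r * x u = c * (\<Sum>v\<in>verts G. x v)"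
    if "\<forall>v\<in>verts G. (\<Sum>u\<in>nbrs G v. x u) = r * x v" "u \<in> verts G" for r x u
  proof -
    have "p r * x u = (\<Sum>k<m. q k * (\<Sum>v\<in>verts G. walks G k u v * x v))"
      unfolding p_def by (simp only: walks_eigenvector[OF that] sum_distrib_right mult.assoc)
    also have "\<dots> = (\<Sum>v\<in>verts G. (\<Sum>k<m. q k * walks G k u v) * x v)"
      unfolding sum_distrib_left sum_distrib_right
      by (subst sum.swap) (simp add: mult.assoc)
    also have "\<dots> = c * (\<Sum>v\<in>verts G. x v)"
      using hoff that(2) by (simp add: sum_distrib_left)
    finally show ?thesis .
  qed
  have p3: "p 3 = c * n"
  proof -
    obtain u where "u \<in> verts G" using verts_nonempty by blast
    then show ?thesis using p_eig[of "\<lambda>_. 1" 3 u] card_nbrs by (simp add: n_def)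
  qed
  have root: "p r = 0" if r: "r \<in># spectrum G" "r \<noteq> 3" for r
  proof -
    obtain x u where x: "u \<in> verts G" "x u \<noteq> 0" "\<forall>v\<in>verts G. (\<Sum>u\<in>nbrs G v. x u) = r * x v"
      using r unfolding spectrum_iff_eigenvector by blast
    \<comment> \<open>Summing the eigenvalue equation over all vertices counts each entry three
      times, so the total vanishes when \<open>r\<close> differs from 3.\<close>
    have "r * (\<Sum>v\<in>verts G. x v) = (\<Sum>v\<in>verts G. \<Sum>z\<in>nbrs G v. x z)"
      using x by (simp add: sum_distrib_left)
    also have "\<dots> = (\<Sum>z\<in>verts G. \<Sum>v\<in>nbrs G z. x z)" by (rule sum_verts_nbrs_swap)
    also have "\<dots> = 3 * (\<Sum>v\<in>verts G. x v)" using card_nbrs by (simp add: sum_distrib_left)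
    finally have "(\<Sum>v\<in>verts G. x v) = 0" using r by simp
    then show ?thesis using p_eig[OF x(3,1)] x(2) by simp
  qed
  have trace: "(\<Sum>r\<in>#spectrum G. p r) = c * n"
  proof -
    have "(\<Sum>r\<in>#spectrum G. p r) = (\<Sum>v\<in>verts G. \<Sum>k<m. q k * walks G k v v)"
      unfolding p_def sum_spectrum_poly sum_distrib_left by (rule sum.swap)
    then show ?thesis using hoff by (simp add: n_def)
  qed
  obtain M where M: "spectrum G = add_mset 3 M"
    using three_in_spectrum by (metis insert_DiffM)
  have "3 \<notin># M"
  proof
    assume "3 \<in># M"
    then obtain N where N: "M = add_mset 3 N" by (metis insert_DiffM)
    \<comment> \<open>Two copies of 3 already contribute \<open>2 * c * n\<close>, and nothing else
      is negative, whereas the trace is \<open>c * n\<close>.\<close>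
    have "p r \<ge> 0" if "r \<in># N" for r
      using root[of r] that M N p3 c n by (cases "r = 3") auto
    then have "(\<Sum>r\<in>#N. p r) \<ge> (\<Sum>r\<in>#N. 0)" by (intro sum_mset_mono)
    moreover have "c * n > 0" using c n by simp
    ultimately show False using trace M N p3 by simp
  qed
  then show "\<exists>M. spectrum G = add_mset 3 M \<and> (\<forall>r\<in>#M. r \<noteq> 3 \<and> (\<Sum>k<m. q k * r ^ k) = 0)"
    using M root unfolding p_def by (intro exI[of _ M]) auto
qed

lemma (in graph) labelling_imp_cubic:
  assumes lab: "labelling G nb vs" and "nb \<noteq> []"
  shows "cubic G"
proof
  fix v assume "v \<in> verts G"
  then obtain i where i: "i < length nb" "v = vs ! i" using labelling_obtain_index[OF lab] by blast
  have "(\<Sum>u\<in>nbrs G v. 1 :: real) = 3"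
    unfolding i(2) using sum_nbrs_labelling[OF lab i(1), of "\<lambda>_. 1"] lab i
    by (simp add: labelling_def adjacency_list_def sum_list_triv)
  then show "card (nbrs G v) = 3" by simp
next
  show "verts G \<noteq> {}" using assms by (auto simp: labelling_def)
qed

lemma (in cubic) connected_cubic_graphI: "connected G \<Longrightarrow> connected_cubic_graph G"
  using card_nbrs graph_axioms
  by (simp add: connected_cubic_graph_def regular_graph_def out_degree_eq_card_nbrs)

text \<open>The certificate for each model graph: \<open>qs\<close> holds the coefficients of a
  Hoffman polynomial \<open>q\<close>, for which \<open>c\<close> is \<open>q(3)\<close> divided by
  the number of vertices, and \<open>xs\<close> is an eigenvector for \<open>t\<close>. Apart from
  one copy of 3 all eigenvalues are roots of \<open>q\<close>, hence at most \<open>t\<close>, and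
  \<open>xs\<close> shows that \<open>t\<close> occurs.\<close>

lemma connected_cubic_graph_mu_1_eq:
  fixes qs xs :: "int list" and t c :: int
  assumes G: "graph G" and lab: "labelling G nb vs" and c: "c > 0"
    and hoff: "map (\<lambda>i. matrix_poly_row nb i qs) [0..<length nb] =
      replicate (length nb) (replicate (length nb) c)"
    and xs: "map (\<lambda>ls. \<Sum>l\<leftarrow>ls. xs ! l) nb = map ((*) t) xs" "\<exists>x\<in>set xs. x \<noteq> 0"
    and t: "t < 3" "\<And>r :: real. (\<Sum>k<length qs. of_int (qs ! k) * r ^ k) = 0 \<Longrightarrow> r \<le> of_int t"
  shows "connected_cubic_graph G \<and> mu 1 G = of_int t"
proof -
  interpret graph G by fact
  have len: "length xs = length nb" using arg_cong[OF xs(1), of length] by simp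
  then have "nb \<noteq> []" using xs(2) by auto
  then interpret cubic G by (rule labelling_imp_cubic[OF lab])
  have hoff': "(\<Sum>k<length qs. of_int (qs ! k) * walks G k u v) = of_int c"
    if uv: "u \<in> verts G" "v \<in> verts G" for u v
  proof -
    obtain i j where ij: "i < length nb" "u = vs ! i" "j < length nb" "v = vs ! j"
      using uv labelling_obtain_index[OF lab] by metis
    have "matrix_poly_row nb i qs = replicate (length nb) c"
      using arg_cong[OF hoff, of "\<lambda>l. l ! i"] ij by simp
    then show ?thesis using matrix_poly_row[OF lab ij(1) ij(3)] ij by simp
  qed
  have c': "real_of_int c > 0" using c by simp
  note hp = hoffman_polynomial[OF c' hoff']
  obtain M where M: "spectrum G = add_mset 3 M"
    "\<forall>r\<in>#M. r \<noteq> 3 \<and> (\<Sum>k<length qs. of_int (qs ! k) * r ^ k) = 0"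
    using hp(2) by blast
  have "real_of_int t \<in># spectrum G"
    unfolding spectrum_iff_eigenvector
  proof (intro exI conjI ballI)
    define x where "x v = real_of_int (xs ! (THE i. i < length nb \<and> vs ! i = v))" for v
    have x: "x (vs ! i) = of_int (xs ! i)" if "i < length nb" for i
      unfolding x_def using that labelling_nth_eq[OF lab]
      by (intro arg_cong[where f = "\<lambda>j. of_int (xs ! j)"] the_equality) auto
    obtain i where i: "i < length nb" "xs ! i \<noteq> 0" using xs(2) len by (metis in_set_conv_nth)
    then show "\<exists>v\<in>verts G. x v \<noteq> 0"
      using x labelling_nth_in_verts[OF lab] by (metis of_int_eq_0_iff)
    fix v assume "v \<in> verts G"
    then obtain i where i: "i < length nb" "v = vs ! i" using labelling_obtain_index[OF lab] by blast
    have "(\<Sum>u\<in>nbrs G v. x u) = (\<Sum>l\<leftarrow>nb ! i. of_int (xs ! l))"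
      unfolding i(2) sum_nbrs_labelling[OF lab i(1)]
      using x labelling_lt[OF lab i(1)] by (intro arg_cong[where f = sum_list] map_cong) auto
    also have "\<dots> = of_int (\<Sum>l\<leftarrow>nb ! i. xs ! l)" by (simp add: of_int_hom.hom_sum_list o_def)
    also have "(\<Sum>l\<leftarrow>nb ! i. xs ! l) = t * xs ! i"
      using arg_cong[OF xs(1), of "\<lambda>l. l ! i"] i len by simp
    finally show "(\<Sum>u\<in>nbrs G v. x u) = of_int t * x v" using x i by simp
  qed
  then have "real_of_int t \<in># M" using M t(1) by auto
  then have "mu 1 G = of_int t" using M t by (intro mu_1_eqI[OF M(1)]) auto
  then show ?thesis using connected_cubic_graphI[OF hp(1)] by simp
qed


section \<open>The six graphs\<close>

lemma graph_with_projI: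
  assumes "finite (pverts H)" and "\<And>u v. (u, v) \<in> parcs H \<Longrightarrow> u \<in> pverts H \<and> u \<noteq> v \<and> (v, u) \<in> parcs H"
  shows "graph (with_proj H)"
proof -
  interpret pair_graph H
  proof
    show "finite (parcs H)"
      by (rule finite_subset[of _ "pverts H \<times> pverts H"]) (use assms in auto)
    show "symmetric (with_proj H)" using assms(2) by (auto simp: symmetric_def sym_def)
  qed (use assms in \<open>auto dest: assms(2)\<close>)
  show ?thesis by unfold_locales
qed

lemma nbrs_with_proj: "nbrs (with_proj H) u = {v. (u, v) \<in> parcs H}"
  by (simp add: nbrs_def)

lemma all_less_Suc_iff: "(\<forall>i<Suc n. P i) \<longleftrightarrow> (\<forall>i<n. P i) \<and> P n"
  by (auto simp: less_Suc_eq)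

lemma labelling_with_projI:
  assumes graph: "graph (with_proj H)"
    and nb: "adjacency_list nb" "length ws = length nb"
    and ws: "distinct ws" "set ws = pverts H"
    and adj: "\<forall>i<length nb. \<forall>j<length nb. (ws ! i, ws ! j) \<in> parcs H \<longleftrightarrow> j \<in> set (nb ! i)"
  shows "labelling (with_proj H) nb ws"
  unfolding labelling_def
proof (intro conjI allI impI)
  interpret graph "with_proj H" by fact
  fix i assume i: "i < length nb"
  have lt: "l < length nb" if "l \<in> set (nb ! i)" for l
    using nb i that by (auto simp: adjacency_list_def)
  show "nbrs (with_proj H) (ws ! i) = (!) ws ` set (nb ! i)"
  proof (intro equalityI subsetI)
    fix v assume v: "v \<in> nbrs (with_proj H) (ws ! i)"
    then have "v \<in> set ws" using nbrs_verts(2) ws by simp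
    then obtain j where "j < length nb" "v = ws ! j" using nb by (metis in_set_conv_nth)
    then show "v \<in> (!) ws ` set (nb ! i)" using v adj i by (auto simp: nbrs_with_proj)
  qed (use adj i lt in \<open>auto simp: nbrs_with_proj\<close>)
qed (use nb ws in auto)

text \<open>The numberings follow the shape of the graphs: \<open>K33_nbrs\<close> by parts,
  \<open>prism_nbrs\<close> by triangles with \<open>i\<close> matched to \<open>i + 3\<close>,
  \<open>cube_nbrs\<close> and \<open>petersen_nbrs\<close> by distance from 0,
  \<open>wagner_nbrs\<close> by residues modulo 8.\<close>

definition K4_nbrs :: "nat list list" where
  "K4_nbrs = [[1,2,3], [0,2,3], [0,1,3], [0,1,2]]"

definition K33_nbrs :: "nat list list" where
  "K33_nbrs = [[3,4,5], [3,4,5], [3,4,5], [0,1,2], [0,1,2], [0,1,2]]"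

definition prism_nbrs :: "nat list list" where
  "prism_nbrs = [[1,2,3], [0,2,4], [0,1,5], [4,5,0], [3,5,1], [3,4,2]]"

definition cube_nbrs :: "nat list list" where
  "cube_nbrs = [[1,2,3], [0,4,5], [0,4,6], [0,5,6], [1,2,7], [1,3,7], [2,3,7], [4,5,6]]"

definition wagner_nbrs :: "nat list list" where
  "wagner_nbrs = [[1,7,4], [2,0,5], [3,1,6], [4,2,7], [5,3,0], [6,4,1], [7,5,2], [0,6,3]]"

definition petersen_nbrs :: "nat list list" where
  "petersen_nbrs = [[1,2,3], [0,4,5], [0,6,7], [0,8,9], [1,6,8], [1,7,9], [2,4,9], [2,5,8],
    [3,4,7], [3,5,6]]"

lemma K4: "graph (with_proj (complete_graph 4))"
    "labelling (with_proj (complete_graph 4)) K4_nbrs [0,1,2,3]"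
proof -
  show "graph (with_proj (complete_graph 4))"
    by (rule graph_with_projI) (auto simp: complete_graph_def)
  show "labelling (with_proj (complete_graph 4)) K4_nbrs [0,1,2,3]"
    unfolding labelling_def adjacency_list_def K4_nbrs_def
    by (auto simp: all_less_Suc_iff nbrs_with_proj complete_graph_def)
qed

lemma K33: "graph (with_proj (complete_bipartite_graph 3 3))"
    "labelling (with_proj (complete_bipartite_graph 3 3)) K33_nbrs [Inl 0, Inl 1, Inl 2, Inr 0, Inr 1, Inr 2]"
proof -
  show "graph (with_proj (complete_bipartite_graph 3 3))"
    by (rule graph_with_projI) (auto simp: complete_bipartite_graph_def)
  have "{..<3} = {0, 1, 2 :: nat}" by auto
  then show "labelling (with_proj (complete_bipartite_graph 3 3)) K33_nbrs
      [Inl 0, Inl 1, Inl 2, Inr 0, Inr 1, Inr 2]"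
    unfolding labelling_def adjacency_list_def K33_nbrs_def
    by (auto simp: all_less_Suc_iff nbrs_with_proj complete_bipartite_graph_def)
qed

lemma prism: "graph (with_proj triangular_prism)"
    "labelling (with_proj triangular_prism) prism_nbrs [(0,0), (1,0), (2,0), (0,1), (1,1), (2,1)]"
proof -
  show graph: "graph (with_proj triangular_prism)"
    by (rule graph_with_projI)
      (auto simp: triangular_prism_def cartesian_product_graph_def complete_graph_def)
  have "{..<3} = {0, 1, 2 :: nat}" "{..<2} = {0, 1 :: nat}" by auto
  then show "labelling (with_proj triangular_prism) prism_nbrs
      [(0,0), (1,0), (2,0), (0,1), (1,1), (2,1)]"
    by (intro labelling_with_projI graph)
      (auto simp: adjacency_list_def prism_nbrs_def all_less_Suc_iff triangular_prism_def
        cartesian_product_graph_def complete_graph_def)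
qed

lemma pverts_cube_graph: "pverts cube_graph =
    set [[False,False,False], [True,False,False], [False,True,False], [False,False,True],
      [True,True,False], [True,False,True], [False,True,True], [True,True,True]]"
proof (rule Set.set_eqI)
  fix xs
  show "xs \<in> pverts cube_graph \<longleftrightarrow> xs \<in> set [[False,False,False], [True,False,False],
      [False,True,False], [False,False,True], [True,True,False], [True,False,True],
      [False,True,True], [True,True,True]]"
  proof (cases "length xs = 3")
    case True
    then obtain a b c where "xs = [a, b, c]" by (auto simp: length_Suc_conv numeral_3_eq_3)
    then show ?thesis by (cases a; cases b; cases c) (simp_all add: cube_graph_def)
  qed (auto simp: cube_graph_def)
qed

lemma hamming_distance_3:
  "card {i. i < 3 \<and> [a, b, c] ! i \<noteq> [a', b', c'] ! i} =
    of_bool (a \<noteq> a') + of_bool (b \<noteq> b') + of_bool (c \<noteq> c')"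
proof -
  have "{i. i < 3 \<and> [a, b, c] ! i \<noteq> [a', b', c'] ! i} =
      (if a \<noteq> a' then {0} else {}) \<union> (if b \<noteq> b' then {1} else {}) \<union> (if c \<noteq> c' then {2} else {})"
    by (auto simp: less_Suc_eq numeral_3_eq_3 numeral_2_eq_2)
  then show ?thesis by auto
qed

lemma cube: "graph (with_proj cube_graph)"
    "labelling (with_proj cube_graph) cube_nbrs
      [[False,False,False], [True,False,False], [False,True,False], [False,False,True],
      [True,True,False], [True,False,True], [False,True,True], [True,True,True]]"
proof -
  show graph: "graph (with_proj cube_graph)"
  proof (rule graph_with_projI)
    show "finite (pverts cube_graph)" unfolding pverts_cube_graph by simp
    have "{i. i < 3 \<and> xs ! i \<noteq> ys ! i} = {i. i < 3 \<and> ys ! i \<noteq> (xs ! i :: bool)}" for xs ys by auto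
    then show "u \<in> pverts cube_graph \<and> u \<noteq> v \<and> (v, u) \<in> parcs cube_graph"
      if "(u, v) \<in> parcs cube_graph" for u v
      using that by (auto simp: cube_graph_def)
  qed
  show "labelling (with_proj cube_graph) cube_nbrs
      [[False,False,False], [True,False,False], [False,True,False], [False,False,True],
      [True,True,False], [True,False,True], [False,True,True], [True,True,True]]"
  proof (intro labelling_with_projI graph)
    have "(([a, b, c], [a', b', c']) \<in> parcs cube_graph) \<longleftrightarrow>
        of_bool (a \<noteq> a') + of_bool (b \<noteq> b') + of_bool (c \<noteq> c') = (1 :: nat)" for a b c a' b' c'
      unfolding hamming_distance_3[symmetric] by (simp add: cube_graph_def)
    then show "\<forall>i<length cube_nbrs. \<forall>j<length cube_nbrs.
        ([[False,False,False], [True,False,False], [False,True,False], [False,False,True],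
          [True,True,False], [True,False,True], [False,True,True], [True,True,True]] ! i,
         [[False,False,False], [True,False,False], [False,True,False], [False,False,True],
          [True,True,False], [True,False,True], [False,True,True], [True,True,True]] ! j)
        \<in> parcs cube_graph \<longleftrightarrow> j \<in> set (cube_nbrs ! i)"
      by (simp add: cube_nbrs_def all_less_Suc_iff)
  qed (simp_all add: adjacency_list_def cube_nbrs_def pverts_cube_graph)
qed

lemma wagner: "graph (with_proj wagner_graph)"
    "labelling (with_proj wagner_graph) wagner_nbrs [0,1,2,3,4,5,6,7]"
proof -
  have range: "{0..<8} = {0,1,2,3,4,5,6,7 :: int}" by auto
  show graph: "graph (with_proj wagner_graph)"
    by (rule graph_with_projI) (auto simp: wagner_graph_def range)
  show "labelling (with_proj wagner_graph) wagner_nbrs [0,1,2,3,4,5,6,7]"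
    by (intro labelling_with_projI graph)
      (simp_all add: adjacency_list_def wagner_nbrs_def all_less_Suc_iff wagner_graph_def range)
qed

lemma two_subsets_of_5: "{S. S \<subseteq> {1..5 :: nat} \<and> card S = 2} =
    {{1,2}, {3,4}, {3,5}, {4,5}, {1,5}, {2,5}, {1,4}, {2,4}, {1,3}, {2,3}}"
proof -
  have five: "{1..5} = {1,2,3,4,5 :: nat}" by auto
  show ?thesis
  proof (intro equalityI subsetI)
    fix S :: "nat set" assume "S \<in> {S. S \<subseteq> {1..5} \<and> card S = 2}"
    then obtain a b where ab: "S = {a, b}" "a \<noteq> b" "{a, b} \<subseteq> {1,2,3,4,5}"
      unfolding five by (auto simp: card_2_iff)
    then have "a \<in> {1,2,3,4,5}" "b \<in> {1,2,3,4,5}" by auto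
    then show "S \<in> {{1,2}, {3,4}, {3,5}, {4,5}, {1,5}, {2,5}, {1,4}, {2,4}, {1,3}, {2,3}}"
      unfolding ab(1) using ab(2)
      by (elim insertE emptyE; hypsubst) (simp_all add: doubleton_eq_iff)
  qed (auto simp: five)
qed

lemma petersen: "graph (with_proj petersen_graph)"
    "labelling (with_proj petersen_graph) petersen_nbrs
      [{1,2}, {3,4}, {3,5}, {4,5}, {1,5}, {2,5}, {2,4}, {1,4}, {2,3}, {1,3}]"
proof -
  have pverts: "pverts petersen_graph = {S. S \<subseteq> {1..5} \<and> card S = 2}"
    by (simp add: petersen_graph_def)
  show graph: "graph (with_proj petersen_graph)"
  proof (rule graph_with_projI)
    show "finite (pverts petersen_graph)" unfolding pverts two_subsets_of_5 by simp
  qed (auto simp: petersen_graph_def)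
  show "labelling (with_proj petersen_graph) petersen_nbrs
      [{1,2}, {3,4}, {3,5}, {4,5}, {1,5}, {2,5}, {2,4}, {1,4}, {2,3}, {1,3}]"
  proof (intro labelling_with_projI graph)
    show "set [{1,2}, {3,4}, {3,5}, {4,5}, {1,5}, {2,5}, {2,4}, {1,4}, {2,3}, {1,3}] =
        pverts petersen_graph"
      unfolding pverts two_subsets_of_5 by auto
  qed (simp_all add: adjacency_list_def petersen_nbrs_def all_less_Suc_iff petersen_graph_def
      doubleton_eq_iff)
qed

section \<open>Second eigenvalues of the six graphs\<close>

lemma mu_1_K4:
  assumes "graph G" "labelling G K4_nbrs vs"
  shows "connected_cubic_graph G \<and> mu 1 G = -1"
proof -
  have "connected_cubic_graph G \<and> mu 1 G = of_int (-1)"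
  \<comment> \<open>Here and in the next five proofs \<open>qs\<close> expands the product of
    \<open>X - r\<close> over the distinct eigenvalues \<open>r\<close> other than 3; here this is
    \<open>X + 1\<close>.\<close>
  proof (rule connected_cubic_graph_mu_1_eq[OF assms, where qs = "[1, 1]" and c = 1
        and xs = "[1, -1, 0, 0]"])
    show "map (\<lambda>i. matrix_poly_row K4_nbrs i [1, 1]) [0..<length K4_nbrs] =
        replicate (length K4_nbrs) (replicate (length K4_nbrs) 1)"
      by code_simp
    fix r :: real
    assume "(\<Sum>k<length [1, 1 :: int]. of_int ([1, 1] ! k) * r ^ k) = 0"
    then show "r \<le> of_int (-1)" by simp
  qed (simp_all add: K4_nbrs_def)
  then show ?thesis by simp
qed

lemma mu_1_K33:
  assumes "graph G" "labelling G K33_nbrs vs"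
  shows "connected_cubic_graph G \<and> mu 1 G = 0"
proof -
  have "connected_cubic_graph G \<and> mu 1 G = of_int 0"
  \<comment> \<open>Vertices 0 and 1 have the same neighbours, so their difference lies in the
    kernel.\<close>
  proof (rule connected_cubic_graph_mu_1_eq[OF assms, where qs = "[0, 3, 1]" and c = 3
        and xs = "[1, -1, 0, 0, 0, 0]"])
    show "map (\<lambda>i. matrix_poly_row K33_nbrs i [0, 3, 1]) [0..<length K33_nbrs] =
        replicate (length K33_nbrs) (replicate (length K33_nbrs) 3)"
      by code_simp
    fix r :: real
    assume "(\<Sum>k<length [0, 3, 1 :: int]. of_int ([0, 3, 1] ! k) * r ^ k) = 0"
    then have "r * (r + 3) = 0" by (simp add: eval_nat_numeral lessThan_Suc algebra_simps)
    then show "r \<le> of_int 0" by auto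
  qed (simp_all add: K33_nbrs_def)
  then show ?thesis by simp
qed

lemma mu_1_prism:
  assumes "graph G" "labelling G prism_nbrs vs"
  shows "connected_cubic_graph G \<and> mu 1 G = 1"
proof -
  have "connected_cubic_graph G \<and> mu 1 G = of_int 1"
  \<comment> \<open>Every vertex has two neighbours in its own triangle and one in the other, so the
    sign vector of the triangles has eigenvalue 2 - 1.\<close>
  proof (rule connected_cubic_graph_mu_1_eq[OF assms, where qs = "[0, -2, 1, 1]" and c = 5
        and xs = "[1, 1, 1, -1, -1, -1]"])
    show "map (\<lambda>i. matrix_poly_row prism_nbrs i [0, -2, 1, 1]) [0..<length prism_nbrs] =
        replicate (length prism_nbrs) (replicate (length prism_nbrs) 5)"
      by code_simp
    fix r :: real
    assume "(\<Sum>k<length [0, -2, 1, 1 :: int]. of_int ([0, -2, 1, 1] ! k) * r ^ k) = 0"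
    then have "r * (r - 1) * (r + 2) = 0" by (simp add: eval_nat_numeral lessThan_Suc algebra_simps)
    then show "r \<le> of_int 1" by auto
  qed (simp_all add: prism_nbrs_def)
  then show ?thesis by simp
qed

lemma mu_1_cube:
  assumes "graph G" "labelling G cube_nbrs vs"
  shows "connected_cubic_graph G \<and> mu 1 G = 1"
proof -
  have "connected_cubic_graph G \<and> mu 1 G = of_int 1"
  \<comment> \<open>\<open>xs\<close> is the sign of the first coordinate, which changes along
    exactly one of the three edges at a vertex.\<close>
  proof (rule connected_cubic_graph_mu_1_eq[OF assms, where qs = "[-3, -1, 3, 1]" and c = 6
        and xs = "[1, -1, 1, 1, -1, -1, 1, -1]"])
    show "map (\<lambda>i. matrix_poly_row cube_nbrs i [-3, -1, 3, 1]) [0..<length cube_nbrs] =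
        replicate (length cube_nbrs) (replicate (length cube_nbrs) 6)"
      by code_simp
    fix r :: real
    assume "(\<Sum>k<length [-3, -1, 3, 1 :: int]. of_int ([-3, -1, 3, 1] ! k) * r ^ k) = 0"
    then have "(r - 1) * (r + 1) * (r + 3) = 0"
      by (simp add: eval_nat_numeral lessThan_Suc algebra_simps)
    then show "r \<le> of_int 1" by auto
  qed (simp_all add: cube_nbrs_def)
  then show ?thesis by simp
qed

lemma mu_1_wagner:
  assumes "graph G" "labelling G wagner_nbrs vs"
  shows "connected_cubic_graph G \<and> mu 1 G = 1"
proof -
  have "connected_cubic_graph G \<and> mu 1 G = of_int 1"
  \<comment> \<open>\<open>xs\<close> is a character of the cyclic group of order 4 (its real part):
    the values at \<open>i - 1\<close> and \<open>i + 1\<close> cancel, and that at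
    \<open>i + 4\<close> repeats the value at \<open>i\<close>. The polynomial also has the
    irrational roots \<open>-1 + sqrt 2\<close> and \<open>-1 - sqrt 2\<close>.\<close>
  proof (rule connected_cubic_graph_mu_1_eq[OF assms, where qs = "[1, -2, -2, 2, 1]" and c = 14
        and xs = "[1, 0, -1, 0, 1, 0, -1, 0]"])
    show "map (\<lambda>i. matrix_poly_row wagner_nbrs i [1, -2, -2, 2, 1]) [0..<length wagner_nbrs] =
        replicate (length wagner_nbrs) (replicate (length wagner_nbrs) 14)"
      by code_simp
    fix r :: real
    assume "(\<Sum>k<length [1, -2, -2, 2, 1 :: int]. of_int ([1, -2, -2, 2, 1] ! k) * r ^ k) = 0"
    then have "(r - 1) * (r + 1) * ((r + 1)\<^sup>2 - 2) = 0"
      by (simp add: eval_nat_numeral lessThan_Suc algebra_simps)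
    moreover have "r \<le> 1" if "(r + 1)\<^sup>2 = 2"
    proof (rule ccontr)
      assume "\<not> r \<le> 1"
      then have "(r + 1)\<^sup>2 > 2\<^sup>2" by (intro power_strict_mono) auto
      then show False using that by simp
    qed
    ultimately show "r \<le> of_int 1" by auto
  qed (simp_all add: wagner_nbrs_def)
  then show ?thesis by simp
qed

lemma mu_1_petersen:
  assumes "graph G" "labelling G petersen_nbrs vs"
  shows "connected_cubic_graph G \<and> mu 1 G = 1"
proof -
  have "connected_cubic_graph G \<and> mu 1 G = of_int 1"
  \<comment> \<open>\<open>xs\<close> depends only on the distance from vertex 0. The values 3, 1,
    -1 satisfy 1 + 1 + 1 = 3, 3 - 1 - 1 = 1 and 1 - 1 - 1 = -1.\<close>
  proof (rule connected_cubic_graph_mu_1_eq[OF assms, where qs = "[-2, 1, 1]" and c = 1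
        and xs = "[3, 1, 1, 1, -1, -1, -1, -1, -1, -1]"])
    show "map (\<lambda>i. matrix_poly_row petersen_nbrs i [-2, 1, 1]) [0..<length petersen_nbrs] =
        replicate (length petersen_nbrs) (replicate (length petersen_nbrs) 1)"
      by code_simp
    fix r :: real
    assume "(\<Sum>k<length [-2, 1, 1 :: int]. of_int ([-2, 1, 1] ! k) * r ^ k) = 0"
    then have "(r - 1) * (r + 2) = 0"
      by (simp add: eval_nat_numeral lessThan_Suc algebra_simps)
    then show "r \<le> of_int 1" by auto
  qed (simp_all add: petersen_nbrs_def)
  then show ?thesis by simp
qed


section \<open>Classification\<close>

lemma even_le_10:
  fixes n :: nat
  assumes "even n" "4 \<le> n" "n \<le> 10"
  shows "n = 4 \<or> n = 6 \<or> n = 8 \<or> n = 10"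
  using assms by presburger

text \<open>The handshake argument: the pairs that increase under the numbering \<open>f\<close> and
  their mirror images partition \<open>R\<close>. Applied to the \<open>3 * n\<close> arcs of a
  cubic graph it makes \<open>n\<close> even.\<close>

lemma even_card_symmetric_irreflexive:
  fixes R :: "('a \<times> 'a) set"
  assumes "finite R" "sym R" "irrefl R"
  shows "even (card R)"
proof -
  obtain f :: "'a \<Rightarrow> nat" where f: "inj_on f (Field R)"
    using finite_imp_inj_to_nat_seg[OF finite_Field[OF assms(1)]] by blast
  define A where "A = {p \<in> R. f (fst p) < f (snd p)}"
  have "f u \<noteq> f v" if "(u, v) \<in> R" for u v
  proof
    assume "f u = f v"
    moreover have "u \<in> Field R" "v \<in> Field R" using that by (auto simp: Field_def)
    ultimately have "u = v" using f by (simp add: inj_on_eq_iff)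
    then show False using that assms(3) by (simp add: irrefl_def)
  qed
  then have "R = A \<union> prod.swap ` A"
    using assms(2) by (force simp: A_def sym_def image_iff neq_iff)
  moreover have "A \<inter> prod.swap ` A = {}" by (auto simp: A_def)
  moreover have "finite A" using assms(1) by (simp add: A_def)
  moreover have "card (prod.swap ` A) = card A" by (intro card_image) simp
  ultimately have "card R = 2 * card A" by (metis card_Un_disjoint finite_imageI mult_2)
  then show ?thesis by simp
qed

section \<open>Parity, tools for reconstruction, graphs on four and six vertices\<close>

context cubic
begin

lemma even_card_verts: "even (card (verts G))"
proof -
  have "(SIGMA u : verts G. nbrs G u) = arcs_ends G"
    by (auto simp: nbrs_def)
  moreover have "card (SIGMA u : verts G. nbrs G u) = 3 * card (verts G)"
    using card_nbrs finite_nbrs by (simp add: card_SigmaI)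
  moreover have "finite (SIGMA u : verts G. nbrs G u)"
    by (intro finite_SigmaI finite_nbrs) simp
  moreover have "irrefl (arcs_ends G)" using adj_not_same by (auto simp: irrefl_def)
  moreover have "sym (arcs_ends G)" using sym_arcs by (simp add: symmetric_def)
  ultimately have "even (3 * card (verts G))" by (metis even_card_symmetric_irreflexive)
  then show ?thesis by simp
qed

text \<open>Neighbourhoods are found by exclusion: once only three candidates are left, counting
  makes all of them neighbours.\<close>

lemma nbrs_eqI:
  assumes "x \<in> verts G" "nbrs G x \<subseteq> {p, q, r}"
  shows "nbrs G x = {p, q, r}"
proof -
  have "card {p, q, r} \<le> 3" by (simp add: card_insert_if)
  then show ?thesis using assms card_nbrs by (intro card_seteq) auto
qed

lemma nbrs_eqI':
  assumes "p \<in> nbrs G x" "q \<in> nbrs G x" "r \<in> nbrs G x" and "distinct [p, q, r]"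
  shows "nbrs G x = {p, q, r}"
proof -
  have "card {p, q, r} = card (nbrs G x)"
    using assms card_nbrs[OF nbrs_verts(1)[OF assms(1)]] by simp
  then have "{p, q, r} = nbrs G x" using assms by (intro card_subset_eq finite_nbrs) auto
  then show ?thesis by simp
qed

text \<open>The cardinality forces distinctness, so neighbourhoods can be introduced as bare sets
  and separated when required.\<close>

lemma nbrs_distinct:
  assumes "nbrs G x = {p, q, r}"
  shows "distinct [x, p, q, r]"
proof -
  have "x \<in> verts G" using assms nbrs_verts(1) by blast
  then have "card {p, q, r} = 3" using card_nbrs assms by metis
  moreover have "x \<notin> {p, q, r}" using nbrs_irrefl assms by metis
  ultimately show ?thesis by (auto simp: card_insert_if split: if_splits)
qed

lemma obtain_other_nbrs:
  assumes "u \<in> nbrs G x"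
  obtains p q where "nbrs G x = {u, p, q}"
proof -
  have "card (nbrs G x - {u}) = 2"
    using assms card_nbrs[OF nbrs_verts(1)[OF assms]] finite_nbrs by simp
  then obtain p q where "nbrs G x - {u} = {p, q}" by (auto simp: card_2_iff)
  then show ?thesis using that assms by blast
qed

lemma obtain_third_nbr:
  assumes "u \<in> nbrs G x" "w \<in> nbrs G x" "u \<noteq> w"
  obtains p where "nbrs G x = {u, w, p}"
  using obtain_other_nbrs[OF assms(1)] assms by (metis empty_iff insertE insert_commute)

text \<open>Only one inclusion is asked for at each vertex. The other inclusion, and the fact that
  \<open>vs\<close> exhausts the vertices, follow by counting.\<close>

lemma labellingI:
  assumes nb: "adjacency_list nb" and vs: "distinct vs" "length vs = length nb"
    and card: "card (verts G) = length nb"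
    and adj: "\<forall>i<length nb. \<forall>l\<in>set (nb ! i). vs ! l \<in> nbrs G (vs ! i)"
  shows "labelling G nb vs"
proof -
  have three: "distinct (nb ! i)" "card (set (nb ! i)) = 3" "\<forall>l\<in>set (nb ! i). l < length nb"
    if "i < length nb" for i
    using nb that by (auto simp: adjacency_list_def distinct_card)
  have "vs ! i \<in> verts G" if "i < length nb" for i
  proof -
    have "hd (nb ! i) \<in> set (nb ! i)" using three(2)[OF that] by (intro list.set_sel) auto
    then show ?thesis using adj that nbrs_verts by blast
  qed
  then have sub: "set vs \<subseteq> verts G" using vs by (metis in_set_conv_nth subsetI)
  moreover have "card (set vs) = card (verts G)" using vs card by (simp add: distinct_card)
  ultimately have verts: "set vs = verts G" by (simp add: card_subset_eq)
  have "nbrs G (vs ! i) = (!) vs ` set (nb ! i)" if i: "i < length nb" for i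
  proof -
    have "inj_on ((!) vs) (set (nb ! i))"
      using vs three[OF i] by (auto intro!: inj_onI simp: nth_eq_iff_index_eq)
    then have "card ((!) vs ` set (nb ! i)) = 3" using three[OF i] by (simp add: card_image)
    moreover have "vs ! i \<in> verts G" using vs i verts by (metis nth_mem)
    moreover have "(!) vs ` set (nb ! i) \<subseteq> nbrs G (vs ! i)" using adj i by blast
    ultimately show ?thesis using card_nbrs finite_nbrs by (metis card_subset_eq)
  qed
  then show ?thesis using nb vs verts by (simp add: labelling_def)
qed

lemma card_4_labelling:
  assumes "card (verts G) = 4"
  shows "\<exists>vs. labelling G K4_nbrs vs"
proof -
  have adj: "y \<in> nbrs G x" if "x \<in> verts G" "y \<in> verts G" "x \<noteq> y" for x y
  proof -
    have "nbrs G x \<subseteq> verts G - {x}" using nbrs_verts nbrs_irrefl by blast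
    moreover have "card (verts G - {x}) = card (nbrs G x)" using assms card_nbrs that by simp
    ultimately have "nbrs G x = verts G - {x}" by (simp add: card_subset_eq)
    then show ?thesis using that by blast
  qed
  obtain v where v: "v \<in> verts G" using verts_nonempty by blast
  then obtain a b c where abc: "nbrs G v = {a, b, c}" using obtain_nbrs by metis
  then have "a \<in> verts G" "b \<in> verts G" "c \<in> verts G" using nbrs_verts(2) by blast+
  \<comment> \<open>The reversed list provides the same inequalities with their sides exchanged;
    later reconstructions do likewise.\<close>
  moreover have "distinct [c, b, a, v]" using nbrs_distinct[OF abc] by auto
  ultimately have "labelling G K4_nbrs [v, a, b, c]"
    using assms v nbrs_distinct[OF abc]
    by (intro labellingI) (simp_all add: K4_nbrs_def adjacency_list_def all_less_Suc_iff adj)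
  then show ?thesis ..
qed

text \<open>The neighbours \<open>a\<close>, \<open>b\<close>, \<open>c\<close> of \<open>v\<close>
  are independent, so each must be joined to both vertices that are left over.\<close>

lemma card_6_triangle_free:
  assumes card: "card (verts G) = 6"
    and tf: "\<And>x y z. y \<in> nbrs G x \<Longrightarrow> z \<in> nbrs G x \<Longrightarrow> z \<notin> nbrs G y"
  shows "\<exists>vs. labelling G K33_nbrs vs"
proof -
  obtain v where v: "v \<in> verts G" using verts_nonempty by blast
  then obtain a b c where abc: "nbrs G v = {a, b, c}" using obtain_nbrs by metis
  then have in_verts: "{v, a, b, c} \<subseteq> verts G" using nbrs_verts by blast
  have "card (verts G - {v, a, b, c}) = 2"
    using in_verts card nbrs_distinct[OF abc] by (simp add: card_Diff_subset)
  then obtain d e where de: "verts G - {v, a, b, c} = {d, e}" "d \<noteq> e" by (auto simp: card_2_iff)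
  then have dist: "distinct [v, a, b, c, d, e]" using nbrs_distinct[OF abc] by auto
  have verts: "verts G = {v, a, b, c, d, e}" using de in_verts by blast
  have nb: "nbrs G x = {v, d, e}" if x: "x \<in> {a, b, c}" for x
  proof (rule nbrs_eqI)
    show "x \<in> verts G" using x in_verts by blast
    show "nbrs G x \<subseteq> {v, d, e}"
    proof
      fix y assume y: "y \<in> nbrs G x"
      then have "y \<notin> {a, b, c}" using tf[of x v y] x abc by blast
      moreover have "y \<in> verts G" using y by (rule nbrs_verts(2))
      ultimately show "y \<in> {v, d, e}" using verts by simp
    qed
  qed
  have "distinct [e, d, c, b, a, v]" using dist by auto
  then have "labelling G K33_nbrs [v, d, e, a, b, c]"
    using card dist
    by (intro labellingI)
      (simp_all add: K33_nbrs_def adjacency_list_def all_less_Suc_iff abc nb nbrs_sym[of _ d] nbrs_sym[of _ e])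
  then show ?thesis ..
qed

text \<open>A vertex off the triangle has at most two neighbours among the three outer vertices, so
  it is joined to the triangle. Only three edges leave the triangle, hence they form a matching, and
  the outer vertices need each other.\<close>

lemma card_6_triangle:
  assumes card: "card (verts G) = 6"
    and tri: "b \<in> nbrs G a" "c \<in> nbrs G a" "c \<in> nbrs G b"
  shows "\<exists>vs. labelling G prism_nbrs vs"
proof -
  have abc: "distinct [a, b, c]" using tri nbrs_irrefl by auto
  have sym: "a \<in> nbrs G b" "a \<in> nbrs G c" "b \<in> nbrs G c" using tri nbrs_sym by auto
  obtain a' where a': "nbrs G a = {b, c, a'}"
    using obtain_third_nbr tri abc by (metis distinct_length_2_or_more)
  obtain b' where b': "nbrs G b = {a, c, b'}"
    using obtain_third_nbr tri sym abc by (metis distinct_length_2_or_more)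
  obtain c' where c': "nbrs G c = {a, b, c'}"
    using obtain_third_nbr tri sym abc by (metis distinct_length_2_or_more)
  have in_verts: "{a, b, c} \<subseteq> verts G" using tri nbrs_verts by blast
  define D where "D = verts G - {a, b, c}"
  have cardD: "card D = 3" "finite D"
    using in_verts card abc by (auto simp: D_def card_Diff_subset)
  have "D \<subseteq> {a', b', c'}"
  proof
    fix d assume d: "d \<in> D"
    have "\<not> nbrs G d \<subseteq> D - {d}"
    proof
      assume "nbrs G d \<subseteq> D - {d}"
      then have "card (nbrs G d) \<le> card (D - {d})" using cardD by (intro card_mono) auto
      then show False using card_nbrs[of d] d cardD by (simp add: D_def)
    qed
    then obtain x where "x \<in> nbrs G d" "x \<in> {a, b, c}"
      using nbrs_irrefl nbrs_verts by (fastforce simp: D_def)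
    then have "d \<in> nbrs G x" "x \<in> {a, b, c}" using nbrs_sym by auto
    then show "d \<in> {a', b', c'}" using d a' b' c' by (auto simp: D_def)
  qed
  moreover have "card {a', b', c'} \<le> 3" by (simp add: card_insert_if)
  ultimately have D: "D = {a', b', c'}" using cardD by (intro card_seteq) auto
  then have dist: "distinct [a, b, c, a', b', c']"
    using abc cardD(1) by (auto simp: D_def card_insert_if split: if_splits)
  have verts: "verts G = {a, b, c, a', b', c'}" using D in_verts by (auto simp: D_def)
  have "b \<notin> nbrs G a'" "c \<notin> nbrs G a'" "a \<notin> nbrs G b'" "c \<notin> nbrs G b'" "a \<notin> nbrs G c'" "b \<notin> nbrs G c'"
    using nbrs_sym[of a] nbrs_sym[of b] nbrs_sym[of c] a' b' c' dist by auto
  moreover have sub: "nbrs G x \<subseteq> {a, b, c, a', b', c'} - {x}" for x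
    using verts nbrs_verts(2) nbrs_irrefl by blast
  ultimately have "nbrs G a' \<subseteq> {b', c', a}" "nbrs G b' \<subseteq> {a', c', b}" "nbrs G c' \<subseteq> {a', b', c}"
    using sub[of a'] sub[of b'] sub[of c'] by auto
  then have nb': "nbrs G a' = {b', c', a}" "nbrs G b' = {a', c', b}" "nbrs G c' = {a', b', c}"
    using verts by (auto intro!: nbrs_eqI)
  have "distinct [c', b', a', c, b, a]" using dist by auto
  then have "labelling G prism_nbrs [a, b, c, a', b', c']"
    using card dist
    by (intro labellingI)
      (simp_all add: prism_nbrs_def adjacency_list_def all_less_Suc_iff a' b' c' nb')
  then show ?thesis ..
qed

end


section \<open>Triangle-free cubic graphs on eight and ten vertices\<close>

locale triangle_free_cubic = cubic +
  assumes triangle_free: "y \<in> nbrs G x \<Longrightarrow> z \<in> nbrs G x \<Longrightarrow> z \<notin> nbrs G y"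

context triangle_free_cubic
begin

text \<open>Excluding triangles forces the missing edges from \<open>d\<close> to \<open>s\<close>
  and from \<open>t\<close> to \<open>r\<close> and \<open>s\<close>. Then
  \<open>v, a, t, r, b, d, s, c\<close> is an 8-cycle whose chords join opposite vertices.\<close>

lemma wagner_labelling:
  assumes verts: "verts G = {v, a, b, c, d, r, s, t}" and dist: "distinct [v, a, b, c, d, r, s, t]"
    and v: "nbrs G v = {a, b, c}" and a: "nbrs G a = {v, d, t}" and b: "nbrs G b = {v, d, r}"
    and c: "nbrs G c = {v, r, s}"
  shows "\<exists>vs. labelling G wagner_nbrs vs"
proof -
  have sub: "nbrs G x \<subseteq> {v, a, b, c, d, r, s, t} - {x}" for x
    using verts nbrs_verts(2) nbrs_irrefl by blast
  have "v \<notin> nbrs G d" "c \<notin> nbrs G d" "t \<notin> nbrs G d" "r \<notin> nbrs G d"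
    using nbrs_sym[of v d] nbrs_sym[of c d] triangle_free[of d a t] triangle_free[of d b r] dist v a b c
    by auto
  then have "nbrs G d \<subseteq> {a, b, s}" using sub[of d] by blast
  then have d: "nbrs G d = {a, b, s}" using verts by (intro nbrs_eqI) auto
  have "v \<notin> nbrs G t" "b \<notin> nbrs G t" "c \<notin> nbrs G t" "d \<notin> nbrs G t"
    using nbrs_sym[of v t] nbrs_sym[of b t] nbrs_sym[of c t] triangle_free[of t a d] dist v a b c
    by auto
  then have "nbrs G t \<subseteq> {a, r, s}" using sub[of t] by blast
  then have t: "nbrs G t = {a, r, s}" using verts by (intro nbrs_eqI) auto
  have "b \<in> nbrs G r" "c \<in> nbrs G r" "t \<in> nbrs G r" "c \<in> nbrs G s" "d \<in> nbrs G s" "t \<in> nbrs G s"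
    using nbrs_sym[of _ r] nbrs_sym[of _ s] b c d t by auto
  moreover have "card (verts G) = 8" using verts distinct_card[OF dist] by simp
  moreover have "distinct [t, s, r, d, c, b, a, v]" using dist by auto
  ultimately have "labelling G wagner_nbrs [v, a, t, r, b, d, s, c]"
    using dist
    by (intro labellingI)
      (simp_all add: wagner_nbrs_def adjacency_list_def all_less_Suc_iff v a b c d t)
  then show ?thesis ..
qed

lemma wagner_labelling_of_common_nbr:
  assumes card: "card (verts G) = 8" and v: "nbrs G v = {a, b, c}"
    and d: "d \<noteq> v" "d \<in> nbrs G a" "d \<in> nbrs G b"
    and cover: "\<And>x. x \<in> verts G \<Longrightarrow> x \<notin> {v, a, b, c} \<Longrightarrow> x \<in> nbrs G a \<union> nbrs G b \<union> nbrs G c"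
  shows "\<exists>vs. labelling G wagner_nbrs vs"
proof -
  have vabc: "distinct [v, a, b, c]" using nbrs_distinct[OF v] .
  have in_nbrs: "v \<in> nbrs G a" "v \<in> nbrs G b" "v \<in> nbrs G c" using v nbrs_sym by auto
  have indep: "x \<notin> nbrs G y" if "x \<in> {a, b, c}" "y \<in> {a, b, c}" for x y
    using triangle_free[of y v x] v that by auto
  have d': "d \<notin> {v, a, b, c}" using d indep by blast
  \<comment> \<open>Otherwise the third neighbours \<open>p\<close>, \<open>q\<close>,
    \<open>r\<close> of \<open>a\<close>, \<open>b\<close>, \<open>c\<close> would have only each
    other left and form a triangle.\<close>
  have dc: "d \<notin> nbrs G c"
  proof
    assume "d \<in> nbrs G c"
    have "nbrs G d = {a, b, c}"
      using d \<open>d \<in> nbrs G c\<close> nbrs_sym vabc by (intro nbrs_eqI') auto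
    obtain p q r where pqr: "nbrs G a = {v, d, p}" "nbrs G b = {v, d, q}" "nbrs G c = {v, d, r}"
      using obtain_third_nbr in_nbrs d \<open>d \<in> nbrs G c\<close> by metis
    have "verts G \<subseteq> {v, a, b, c, d, p, q, r}" using cover pqr by blast
    moreover have "card (set [v, a, b, c, d, p, q, r]) \<le> 8" by (rule card_length[THEN order_trans]) simp
    ultimately have verts: "verts G = {v, a, b, c, d, p, q, r}"
      using card by (intro card_seteq) auto
    then have "distinct [v, a, b, c, d, p, q, r]" using card by (intro card_distinct) simp
    moreover have "p \<in> verts G" using verts by simp
    moreover have sub: "nbrs G p \<subseteq> {v, a, b, c, d, p, q, r} - {p}"
      using verts nbrs_verts(2) nbrs_irrefl by blast
    ultimately have "nbrs G p \<subseteq> {a, q, r}"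
      using v pqr \<open>nbrs G d = {a, b, c}\<close> nbrs_sym[of v p] nbrs_sym[of b p] nbrs_sym[of c p] nbrs_sym[of d p]
      by auto
    then have p: "nbrs G p = {a, q, r}" using \<open>p \<in> verts G\<close> by (rule nbrs_eqI[rotated])
    have "nbrs G q \<subseteq> {v, a, b, c, d, p, q, r} - {q}"
      using verts nbrs_verts(2) nbrs_irrefl by blast
    then have "nbrs G q \<subseteq> {b, p, r}"
      using v pqr \<open>nbrs G d = {a, b, c}\<close> nbrs_sym[of v q] nbrs_sym[of a q] nbrs_sym[of c q] nbrs_sym[of d q]
        \<open>distinct [v, a, b, c, d, p, q, r]\<close>
      by auto
    moreover have "q \<in> verts G" using verts by simp
    ultimately have "nbrs G q = {b, p, r}" by (rule nbrs_eqI[rotated])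
    then show False using triangle_free[of q p r] p by simp
  qed
  obtain r s where c: "nbrs G c = {v, r, s}" using obtain_other_nbrs[OF in_nbrs(3)] .
  have vrs: "distinct [c, v, r, s]" using nbrs_distinct[OF c] .
  have rs: "r \<notin> {a, b, d}" "s \<notin> {a, b, d}" using indep[of a c] indep[of b c] c dc by auto
  let ?S = "{v, a, b, c, d, r, s}"
  have "?S \<subseteq> verts G"
    using v c nbrs_verts(1)[OF d(2)] nbrs_verts(2)[OF d(2)] nbrs_verts(2)[of _ v] nbrs_verts(2)[of _ c]
    by auto
  moreover have "card ?S = 7" using vabc d' vrs rs by auto
  ultimately have "card (verts G - ?S) = 1" using card by (simp add: card_Diff_subset)
  then obtain t where t: "verts G - ?S = {t}" by (auto simp: card_1_singleton_iff)
  have verts: "verts G = {v, a, b, c, d, r, s, t}" using t \<open>?S \<subseteq> verts G\<close> by blast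
  have dist: "distinct [v, a, b, c, d, r, s, t]" using t vabc d' vrs rs by auto
  \<comment> \<open>The vertex \<open>t\<close> is adjacent to \<open>a\<close> or to
    \<open>b\<close>; stating the claim for \<open>{a', b'} = {a, b}\<close> covers both
    possibilities.\<close>
  have third: "\<exists>vs. labelling G wagner_nbrs vs"
    if v': "nbrs G v = {a', b', c}" and ab: "{a', b'} = {a, b}" and ta: "t \<in> nbrs G a'" for a' b'
  proof -
    have dist': "distinct [v, a', b', c, d, r, s, t]"
      using dist ab nbrs_distinct[OF v'] by (auto simp: doubleton_eq_iff)
    have d'': "d \<in> nbrs G a'" "d \<in> nbrs G b'" using d ab by (auto simp: doubleton_eq_iff)
    have a: "nbrs G a' = {v, d, t}"
      using obtain_third_nbr[of v a' d] in_nbrs d'' ta dist' ab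
      by (metis distinct_length_2_or_more doubleton_eq_iff empty_iff insert_iff)
    have verts': "verts G = {v, a', b', c, d, r, s, t}" using verts ab by (auto simp: doubleton_eq_iff)
    obtain q where b: "nbrs G b' = {v, d, q}"
      using obtain_third_nbr[of v b' d] in_nbrs d'' dist' ab
      by (metis distinct_length_2_or_more doubleton_eq_iff)
    have "q \<in> verts G" "q \<notin> {v, d, b'}"
      using b nbrs_verts(2)[of q b'] nbrs_distinct[OF b] by auto
    moreover have "q \<notin> {a', c}" using indep[of q b'] b ab by blast
    ultimately consider "q = t" | "q = r" | "q = s" using verts' by blast
    then show ?thesis
    proof cases
      \<comment> \<open>If \<open>b'\<close> also sees \<open>t\<close>, then \<open>r\<close> and
        \<open>s\<close> are left with \<open>c\<close>, \<open>d\<close> and \<open>t\<close>, and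
        \<open>d\<close> receives four neighbours.\<close>
      case 1
      have "nbrs G r \<subseteq> {v, a', b', c, d, r, s, t} - {r}" "nbrs G s \<subseteq> {v, a', b', c, d, r, s, t} - {s}"
        using verts' nbrs_verts(2) nbrs_irrefl by blast+
      then have "nbrs G r \<subseteq> {c, d, t}" "nbrs G s \<subseteq> {c, d, t}"
        using v' a b c dist' 1 nbrs_sym[of v r] nbrs_sym[of a' r] nbrs_sym[of b' r] triangle_free[of r c s]
          nbrs_sym[of v s] nbrs_sym[of a' s] nbrs_sym[of b' s] triangle_free[of s c r]
        by auto
      then have "d \<in> nbrs G r" "d \<in> nbrs G s"
        using nbrs_eqI[of r c d t] nbrs_eqI[of s c d t] verts' by auto
      then have "{a', b', r, s} \<subseteq> nbrs G d" using d'' nbrs_sym by auto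
      then have "card {a', b', r, s} \<le> card (nbrs G d)" using finite_nbrs by (intro card_mono)
      then show ?thesis using dist' card_nbrs[of d] verts' by auto
    next
      case 2
      then show ?thesis using wagner_labelling[OF verts' dist' v' a] b c by auto
    next
      case 3
      have "verts G = {v, a', b', c, d, s, r, t}" "distinct [v, a', b', c, d, s, r, t]"
        using verts' dist' by auto
      then show ?thesis using wagner_labelling[of v a' b' c d s r t] v' a b c 3 by auto
    qed
  qed
  have "t \<in> nbrs G a \<union> nbrs G b" using cover[of t] verts dist c by auto
  moreover have "nbrs G v = {b, a, c}" "{b, a} = {a, b}" using v by auto
  ultimately show ?thesis using third[OF v refl] third[of b a] by blast
qed

text \<open>\<open>d\<close> lies at distance at least 3 from \<open>v\<close> and becomes its
  antipode. Its neighbours are the three remaining vertices \<open>x\<close>, \<open>y\<close>,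
  \<open>z\<close>, which are therefore independent and lead back to \<open>a\<close>,
  \<open>b\<close>, \<open>c\<close>.\<close>

lemma cube_labelling_of_isolated:
  assumes card: "card (verts G) = 8" and v: "nbrs G v = {a, b, c}"
    and d: "d \<in> verts G" "d \<notin> {v, a, b, c}" "d \<notin> nbrs G a \<union> nbrs G b \<union> nbrs G c"
  shows "\<exists>vs. labelling G cube_nbrs vs"
proof -
  have vabc: "distinct [v, a, b, c]" using nbrs_distinct[OF v] .
  have in_nbrs: "v \<in> nbrs G a" "v \<in> nbrs G b" "v \<in> nbrs G c" using v nbrs_sym by auto
  have indep: "x \<notin> nbrs G y" if "x \<in> {a, b, c}" "y \<in> {a, b, c}" for x y
    using triangle_free[of y v x] v that by auto
  obtain x y where a: "nbrs G a = {v, x, y}" using obtain_other_nbrs[OF in_nbrs(1)] .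
  have vxy: "distinct [a, v, x, y]" using nbrs_distinct[OF a] .
  have xy: "x \<notin> {b, c, d}" "y \<notin> {b, c, d}" using indep[of b a] indep[of c a] a d by auto
  let ?S = "{v, a, b, c, d, x, y}"
  have "?S \<subseteq> verts G"
    using v a d nbrs_verts(1)[of a v] nbrs_verts(2)[of _ v] nbrs_verts(2)[of _ a] by auto
  moreover have "card ?S = 7" using vabc d vxy xy by auto
  ultimately have "card (verts G - ?S) = 1" using card by (simp add: card_Diff_subset)
  then obtain z where z: "verts G - ?S = {z}" by (auto simp: card_1_singleton_iff)
  have verts: "verts G = {v, a, b, c, d, x, y, z}" using z \<open>?S \<subseteq> verts G\<close> by blast
  have dist: "distinct [v, a, b, c, d, x, y, z]" using z vabc d vxy xy by auto
  have sub: "nbrs G w \<subseteq> {v, a, b, c, d, x, y, z} - {w}" for w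
    using verts nbrs_verts(2) nbrs_irrefl by blast
  have "nbrs G d \<subseteq> {x, y, z}"
    using sub[of d] v d nbrs_sym[of v d] nbrs_sym[of a d] nbrs_sym[of b d] nbrs_sym[of c d] by auto
  then have nd: "nbrs G d = {x, y, z}" using d by (intro nbrs_eqI)
  have "nbrs G z \<subseteq> {b, c, d}"
    using sub[of z] v a dist nbrs_sym[of v z] nbrs_sym[of a z] triangle_free[of z d x]
      triangle_free[of z d y] nd by auto
  then have nz: "nbrs G z = {b, c, d}" using verts by (intro nbrs_eqI) auto
  have nx: "nbrs G x \<subseteq> {a, b, c, d}"
    using sub[of x] v dist nbrs_sym[of v x] triangle_free[of x d y] triangle_free[of x d z] nd by auto
  have ny: "nbrs G y \<subseteq> {a, b, c, d}"
    using sub[of y] v dist nbrs_sym[of v y] triangle_free[of y d x] triangle_free[of y d z] nd by auto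
  \<comment> \<open>Besides \<open>a\<close> and \<open>d\<close>, the vertex \<open>x\<close> needs
    a neighbour among \<open>b\<close> and \<open>c\<close>; the two choices are symmetric.\<close>
  have main: "\<exists>vs. labelling G cube_nbrs vs"
    if v': "nbrs G v = {a, b', c'}" and bc: "{b', c'} = {b, c}" and xb: "b' \<in> nbrs G x" for b' c'
  proof -
    have dist': "distinct [v, a, b', c', d, x, y, z]"
      using dist bc nbrs_distinct[OF v'] by (auto simp: doubleton_eq_iff)
    have zb: "z \<in> nbrs G b'" "z \<in> nbrs G c'" using nz nbrs_sym[of z] bc by (auto simp: doubleton_eq_iff)
    have b: "nbrs G b' = {v, z, x}"
      using v' zb xb nbrs_sym[of v] nbrs_sym[of x] dist' by (intro nbrs_eqI') auto
    have "b' \<notin> nbrs G y" using b nbrs_sym[of b' y] dist' by auto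
    then have "nbrs G y \<subseteq> {a, c', d}" using ny bc by (auto simp: doubleton_eq_iff)
    then have y: "nbrs G y = {a, c', d}" using verts by (intro nbrs_eqI) auto
    have x: "nbrs G x = {a, b', d}"
      using a xb nd nbrs_sym[of _ x] dist' by (intro nbrs_eqI') auto
    have "v \<in> nbrs G c'" "y \<in> nbrs G c'" using v' y nbrs_sym[of _ c'] by auto
    moreover have "nbrs G z = {b', c', d}" using nz bc by auto
    moreover have "distinct [z, y, x, d, c', b', a, v]" using dist' by auto
    ultimately have "labelling G cube_nbrs [v, a, b', c', x, y, z, d]"
      using card dist' zb
      by (intro labellingI)
        (simp_all add: cube_nbrs_def adjacency_list_def all_less_Suc_iff v' a b nd x y)
    then show ?thesis ..
  qed
  have "\<not> nbrs G x \<subseteq> {a, d}"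
  proof
    assume "nbrs G x \<subseteq> {a, d}"
    then have "card (nbrs G x) \<le> card {a, d}" by (intro card_mono) auto
    then show False using card_nbrs[of x] verts by (simp add: card_insert_if split: if_splits)
  qed
  then have "b \<in> nbrs G x \<or> c \<in> nbrs G x" using nx by blast
  moreover have "nbrs G v = {a, c, b}" "{c, b} = {b, c}" using v by auto
  ultimately show ?thesis using main[OF v refl] main[of c b] by blast
qed

text \<open>Six edges lead from \<open>a\<close>, \<open>b\<close>, \<open>c\<close> to the four
  vertices outside \<open>{v, a, b, c}\<close>. If one of the four receives none, the cube arises.
  Otherwise use that six exceeds four: two of \<open>a\<close>, \<open>b\<close>, \<open>c\<close>
  share a neighbour other than \<open>v\<close>, which leads to the Wagner graph.\<close>

lemma card_8_labelling:
  assumes card: "card (verts G) = 8"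
  shows "(\<exists>vs. labelling G cube_nbrs vs) \<or> (\<exists>vs. labelling G wagner_nbrs vs)"
proof -
  obtain v where v: "v \<in> verts G" using verts_nonempty by blast
  then obtain a b c where abc: "nbrs G v = {a, b, c}" using obtain_nbrs by metis
  have vabc: "distinct [v, a, b, c]" using nbrs_distinct[OF abc] .
  show ?thesis
  proof (cases "\<exists>d\<in>verts G. d \<notin> {v, a, b, c} \<and> d \<notin> nbrs G a \<union> nbrs G b \<union> nbrs G c")
    case True
    then show ?thesis using cube_labelling_of_isolated[OF card abc] by blast
  next
    case False
    then have cover: "x \<in> nbrs G a \<union> nbrs G b \<union> nbrs G c"
      if "x \<in> verts G" "x \<notin> {v, a, b, c}" for x using that by blast
    have card2: "card (nbrs G x - {v}) = 2" if "x \<in> {a, b, c}" for x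
    proof -
      have "v \<in> nbrs G x" using that abc nbrs_sym by auto
      then show ?thesis using card_nbrs[OF nbrs_verts(1)] finite_nbrs by simp
    qed
    let ?N = "\<lambda>x. nbrs G x - {v}"
    have "\<not> (?N a \<inter> ?N b = {} \<and> ?N a \<inter> ?N c = {} \<and> ?N b \<inter> ?N c = {})"
    proof
      assume disj: "?N a \<inter> ?N b = {} \<and> ?N a \<inter> ?N c = {} \<and> ?N b \<inter> ?N c = {}"
      have "card (?N a \<union> ?N b \<union> ?N c) = 6"
        using disj card2 finite_nbrs by (simp add: card_Un_disjoint Int_Un_distrib2)
      moreover have "?N a \<union> ?N b \<union> ?N c \<subseteq> verts G - {v, a, b, c}"
      proof -
        have "nbrs G x \<inter> {a, b, c} = {}" if "x \<in> {a, b, c}" for x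
          using triangle_free[of x v] that abc by blast
        then have "?N x \<subseteq> verts G - {v, a, b, c}" if "x \<in> {a, b, c}" for x
          using that nbrs_verts(2)[of _ x] by blast
        then show ?thesis by simp
      qed
      moreover have "card (verts G - {v, a, b, c}) = 4"
        using card vabc v nbrs_verts(2)[of _ v] abc by (subst card_Diff_subset) auto
      moreover have "finite (verts G - {v, a, b, c})" by simp
      ultimately have "(6 :: nat) \<le> 4" by (metis card_mono)
      then show False by simp
    qed
    then obtain d where "d \<noteq> v" "d \<in> nbrs G a \<inter> nbrs G b \<or> d \<in> nbrs G a \<inter> nbrs G c \<or> d \<in> nbrs G b \<inter> nbrs G c"
      by blast
    moreover have "nbrs G v = {a, c, b}" "nbrs G v = {b, c, a}" using abc by auto
    ultimately show ?thesis
      using wagner_labelling_of_common_nbr[OF card abc, of d] cover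
        wagner_labelling_of_common_nbr[OF card, of v a c b d]
        wagner_labelling_of_common_nbr[OF card, of v b c a d]
      by blast
  qed
qed

text \<open>\<open>no4\<close> says that there are no 4-cycles. Without cycles of length 3 and 4,
  the vertices at distance at most 2 from \<open>v\<close> number 1 + 3 + 6, so they are
  all.\<close>

lemma card_10_labelling:
  assumes card: "card (verts G) = 10"
    and no4: "\<And>x y z w. y \<in> nbrs G x \<Longrightarrow> z \<in> nbrs G x \<Longrightarrow> y \<in> nbrs G w \<Longrightarrow> z \<in> nbrs G w \<Longrightarrow> y \<noteq> z \<Longrightarrow> x = w"
  shows "\<exists>vs. labelling G petersen_nbrs vs"
proof -
  obtain v where v: "v \<in> verts G" using verts_nonempty by blast
  then obtain a b c where abc: "nbrs G v = {a, b, c}" using obtain_nbrs by metis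
  have vabc: "distinct [v, a, b, c]" using nbrs_distinct[OF abc] .
  have in_nbrs: "v \<in> nbrs G a" "v \<in> nbrs G b" "v \<in> nbrs G c" using abc nbrs_sym by auto
  have indep: "x \<notin> nbrs G y" if "x \<in> {a, b, c}" "y \<in> {a, b, c}" for x y
    using triangle_free[of y v x] abc that by auto
  have sep: "z = v" if "z \<in> nbrs G x" "z \<in> nbrs G y" "x \<in> {a, b, c}" "y \<in> {a, b, c}" "x \<noteq> y" for x y z
    using no4[of x v y z] that abc nbrs_sym by blast
  obtain p p' where a: "nbrs G a = {v, p, p'}" using obtain_other_nbrs[OF in_nbrs(1)] .
  obtain q\<^sub>1 q\<^sub>2 where b: "nbrs G b = {v, q\<^sub>1, q\<^sub>2}" using obtain_other_nbrs[OF in_nbrs(2)] .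
  obtain r\<^sub>1 r\<^sub>2 where c: "nbrs G c = {v, r\<^sub>1, r\<^sub>2}" using obtain_other_nbrs[OF in_nbrs(3)] .
  have dist: "distinct [v, a, b, c, p, p', q\<^sub>1, q\<^sub>2, r\<^sub>1, r\<^sub>2]"
  proof -
    have 1: "distinct [a, v, p, p']" "distinct [b, v, q\<^sub>1, q\<^sub>2]" "distinct [c, v, r\<^sub>1, r\<^sub>2]"
      using nbrs_distinct[OF a] nbrs_distinct[OF b] nbrs_distinct[OF c] .
    have "nbrs G x \<inter> nbrs G y = {v}" if "x \<in> {a, b, c}" "y \<in> {a, b, c}" "x \<noteq> y" for x y
      using sep[OF _ _ that] in_nbrs that by blast
    then have "nbrs G a \<inter> nbrs G b = {v}" "nbrs G a \<inter> nbrs G c = {v}" "nbrs G b \<inter> nbrs G c = {v}"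
      using vabc by simp_all
    then have 2: "{p, p'} \<inter> {q\<^sub>1, q\<^sub>2} = {}" "{p, p'} \<inter> {r\<^sub>1, r\<^sub>2} = {}" "{q\<^sub>1, q\<^sub>2} \<inter> {r\<^sub>1, r\<^sub>2} = {}"
      unfolding a b c using 1 by auto
    have "{a, b, c} \<inter> nbrs G x = {}" if "x \<in> {a, b, c}" for x using indep that by blast
    then have "{a, b, c} \<inter> {v, p, p'} = {}" "{a, b, c} \<inter> {v, q\<^sub>1, q\<^sub>2} = {}" "{a, b, c} \<inter> {v, r\<^sub>1, r\<^sub>2} = {}"
      unfolding a[symmetric] b[symmetric] c[symmetric] by blast+
    then show ?thesis using 1 2 vabc by auto
  qed
  have verts: "verts G = {v, a, b, c, p, p', q\<^sub>1, q\<^sub>2, r\<^sub>1, r\<^sub>2}"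
  proof -
    have "set [v, a, b, c, p, p', q\<^sub>1, q\<^sub>2, r\<^sub>1, r\<^sub>2] \<subseteq> verts G"
      using v abc a b c nbrs_verts(2)[of _ v] nbrs_verts(2)[of _ a] nbrs_verts(2)[of _ b]
        nbrs_verts(2)[of _ c] by auto
    moreover have "card (set [v, a, b, c, p, p', q\<^sub>1, q\<^sub>2, r\<^sub>1, r\<^sub>2]) = card (verts G)"
      unfolding distinct_card[OF dist] card by simp
    ultimately have "set [v, a, b, c, p, p', q\<^sub>1, q\<^sub>2, r\<^sub>1, r\<^sub>2] = verts G"
      by (intro card_subset_eq finite_verts)
    then show ?thesis by simp
  qed
  have sub: "nbrs G w \<subseteq> {v, a, b, c, p, p', q\<^sub>1, q\<^sub>2, r\<^sub>1, r\<^sub>2} - {w}" for w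
    using verts nbrs_verts(2) nbrs_irrefl by blast
  \<comment> \<open>Two neighbours among \<open>q\<^sub>1\<close> and \<open>q\<^sub>2\<close> would
    close a 4-cycle through \<open>b\<close>, and similarly for \<open>r\<^sub>1\<close> and
    \<open>r\<^sub>2\<close> through \<open>c\<close>.\<close>
  have one_each: "\<exists>y\<in>{q\<^sub>1, q\<^sub>2}. \<exists>z\<in>{r\<^sub>1, r\<^sub>2}. nbrs G x = {a, y, z}" if x: "x \<in> {p, p'}" for x
  proof -
    have "nbrs G x \<subseteq> {a, q\<^sub>1, q\<^sub>2, r\<^sub>1, r\<^sub>2}"
      using sub[of x] x abc a b c dist nbrs_sym[of v x] nbrs_sym[of b x] nbrs_sym[of c x]
        triangle_free[of p a p'] triangle_free[of p' a p] by auto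
    moreover have "a \<in> nbrs G x" using x a nbrs_sym by auto
    moreover have "\<not> (q\<^sub>1 \<in> nbrs G x \<and> q\<^sub>2 \<in> nbrs G x)"
      using no4[of q\<^sub>1 x q\<^sub>2 b] b dist x by auto
    moreover have "\<not> (r\<^sub>1 \<in> nbrs G x \<and> r\<^sub>2 \<in> nbrs G x)"
      using no4[of r\<^sub>1 x r\<^sub>2 c] c dist x by auto
    ultimately obtain y z where "y \<in> {q\<^sub>1, q\<^sub>2}" "z \<in> {r\<^sub>1, r\<^sub>2}" "nbrs G x \<subseteq> {a, y, z}" by blast
    moreover have "x \<in> verts G" using x verts by auto
    ultimately show ?thesis using nbrs_eqI by meson
  qed
  obtain q r where p: "q \<in> {q\<^sub>1, q\<^sub>2}" "r \<in> {r\<^sub>1, r\<^sub>2}" "nbrs G p = {a, q, r}"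
    using one_each[of p] by blast
  obtain q' r' where p': "q' \<in> {q\<^sub>1, q\<^sub>2}" "r' \<in> {r\<^sub>1, r\<^sub>2}" "nbrs G p' = {a, q', r'}"
    using one_each[of p'] by blast
  \<comment> \<open>\<open>p\<close> and \<open>p'\<close> already have the common neighbour
    \<open>a\<close>.\<close>
  have "q \<noteq> q'" "r \<noteq> r'"
    using no4[of a p q p'] no4[of a p r p'] p p' dist by auto
  then have qr: "{q\<^sub>1, q\<^sub>2} = {q, q'}" "{r\<^sub>1, r\<^sub>2} = {r, r'}" using p p' by auto
  then have b': "nbrs G b = {v, q, q'}" and c': "nbrs G c = {v, r, r'}" using b c by auto
  have dist': "distinct [v, a, b, c, p, p', q, q', r, r']"
    using dist p(1,2) p'(1,2) \<open>q \<noteq> q'\<close> \<open>r \<noteq> r'\<close> by auto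
  have verts': "verts G = {v, a, b, c, p, p', q, q', r, r'}" using verts qr by blast
  have sub': "nbrs G w \<subseteq> {v, a, b, c, p, p', q, q', r, r'} - {w}" for w
    using verts' nbrs_verts(2) nbrs_irrefl by blast
  \<comment> \<open>The third neighbour cannot be \<open>r\<close>, which would close a triangle
    with \<open>p\<close>.\<close>
  have "nbrs G q \<subseteq> {b, p, r'}"
    using sub'[of q] abc a b' c' p p' dist' nbrs_sym[of v q] nbrs_sym[of a q] nbrs_sym[of c q]
      nbrs_sym[of p' q] triangle_free[of q b q'] triangle_free[of q p r] by auto
  then have q: "nbrs G q = {b, p, r'}" using verts' by (intro nbrs_eqI) auto
  have "nbrs G q' \<subseteq> {b, p', r}"
    using sub'[of q'] abc a b' c' p p' dist' nbrs_sym[of v q'] nbrs_sym[of a q'] nbrs_sym[of c q']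
      nbrs_sym[of p q'] triangle_free[of q' b q] triangle_free[of q' p' r'] by auto
  then have q': "nbrs G q' = {b, p', r}" using verts' by (intro nbrs_eqI) auto
  have "c \<in> nbrs G r" "p \<in> nbrs G r" "q' \<in> nbrs G r" "c \<in> nbrs G r'" "p' \<in> nbrs G r'" "q \<in> nbrs G r'"
    using c' p p' q q' nbrs_sym[of _ r] nbrs_sym[of _ r'] by auto
  moreover have "distinct [r', r, q', q, p', p, c, b, a, v]" using dist' by auto
  ultimately have "labelling G petersen_nbrs [v, a, b, c, p, p', q, q', r, r']"
    using card dist'
    by (intro labellingI)
      (simp_all add: petersen_nbrs_def adjacency_list_def all_less_Suc_iff abc a b' c' p(3) p'(3) q q')
  then show ?thesis ..
qed

end


section \<open>Excluding triangles and 4-cycles by counting closed walks\<close>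

context cubic
begin

lemma walks_3_self_ge:
  assumes "T \<subseteq> nbrs G v"
  shows "(\<Sum>z\<in>T. real (card (nbrs G v \<inter> nbrs G z))) \<le> walks G (Suc (Suc (Suc 0))) v v"
  unfolding walks_Suc[of "Suc (Suc 0)"] walks_2 using assms finite_nbrs by (intro sum_mono2) auto

lemma card_common_nbrs_ge:
  assumes "distinct ps" "set ps \<subseteq> nbrs G u \<inter> nbrs G v"
  shows "real (length ps) \<le> real (card (nbrs G u \<inter> nbrs G v))"
  using card_mono[OF _ assms(2)] finite_nbrs distinct_card[OF assms(1)] by simp

lemma walks_3_triangle:
  assumes "b \<in> nbrs G a" "c \<in> nbrs G a" "c \<in> nbrs G b"
  shows "walks G (Suc (Suc (Suc 0))) a a \<ge> 2"
proof -
  have "b \<noteq> c" using assms nbrs_irrefl by auto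
  moreover have "1 \<le> real (card (nbrs G a \<inter> nbrs G b))" "1 \<le> real (card (nbrs G a \<inter> nbrs G c))"
    using card_common_nbrs_ge[of "[c]" a b] card_common_nbrs_ge[of "[b]" a c] assms nbrs_sym by auto
  ultimately show ?thesis using walks_3_self_ge[of "{b, c}" a] assms by simp
qed

lemma walks_3_diamond:
  assumes "b \<in> nbrs G a" "c \<in> nbrs G a" "d \<in> nbrs G a" "c \<in> nbrs G b" "d \<in> nbrs G b" "c \<noteq> d"
  shows "walks G (Suc (Suc (Suc 0))) a a \<ge> 4"
proof -
  have "b \<noteq> c" "b \<noteq> d" using assms nbrs_irrefl by auto
  moreover have "2 \<le> real (card (nbrs G a \<inter> nbrs G b))"
      "1 \<le> real (card (nbrs G a \<inter> nbrs G c))" "1 \<le> real (card (nbrs G a \<inter> nbrs G d))"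
    using card_common_nbrs_ge[of "[c, d]" a b] card_common_nbrs_ge[of "[b]" a c]
      card_common_nbrs_ge[of "[b]" a d] assms nbrs_sym by auto
  ultimately show ?thesis using walks_3_self_ge[of "{b, c, d}" a] assms by simp
qed

lemma closed_walks_ge: "S \<subseteq> verts G \<Longrightarrow> (\<Sum>v\<in>S. walks G k v v) \<le> closed_walks k"
  by (intro sum_mono2) (auto simp: walks_nonneg)

text \<open>Two triangles on a common edge have four closed walks of length 3 at each end of that
  edge and two at each other vertex, 12 in all.\<close>

lemma common_nbr_unique:
  assumes "closed_walks (Suc (Suc (Suc 0))) < 12"
    and "b \<in> nbrs G a" "c \<in> nbrs G a" "d \<in> nbrs G a" "c \<in> nbrs G b" "d \<in> nbrs G b"
  shows "c = d"
proof (rule ccontr)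
  assume cd: "c \<noteq> d"
  have sym: "a \<in> nbrs G b" "a \<in> nbrs G c" "b \<in> nbrs G c" "a \<in> nbrs G d" "b \<in> nbrs G d"
    using assms nbrs_sym by auto
  have "distinct [a, b, c, d]" using assms cd nbrs_irrefl by auto
  moreover have "{a, b, c, d} \<subseteq> verts G" using assms nbrs_verts by blast
  ultimately have "walks G (Suc (Suc (Suc 0))) a a + walks G (Suc (Suc (Suc 0))) b b +
      walks G (Suc (Suc (Suc 0))) c c + walks G (Suc (Suc (Suc 0))) d d \<le> closed_walks (Suc (Suc (Suc 0)))"
    using closed_walks_ge[of "{a, b, c, d}" "Suc (Suc (Suc 0))"] by simp
  moreover have "walks G (Suc (Suc (Suc 0))) a a \<ge> 4" "walks G (Suc (Suc (Suc 0))) b b \<ge> 4"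
    using assms cd sym by (auto intro: walks_3_diamond)
  moreover have "walks G (Suc (Suc (Suc 0))) c c \<ge> 2" "walks G (Suc (Suc (Suc 0))) d d \<ge> 2"
    using assms sym by (auto intro: walks_3_triangle)
  ultimately show False using assms(1) by linarith
qed

text \<open>A triangle provides two closed walks of length 3, one per direction, at each of its
  vertices; two disjoint ones would provide 12.\<close>

lemma triangles_not_disjoint:
  assumes "closed_walks (Suc (Suc (Suc 0))) < 12"
    and abc: "b \<in> nbrs G a" "c \<in> nbrs G a" "c \<in> nbrs G b"
    and xyz: "y \<in> nbrs G x" "z \<in> nbrs G x" "z \<in> nbrs G y"
  shows "{a, b, c} \<inter> {x, y, z} \<noteq> {}"
proof
  assume disj: "{a, b, c} \<inter> {x, y, z} = {}"
  have tri: "(\<Sum>v\<in>{a, b, c}. walks G (Suc (Suc (Suc 0))) v v) \<ge> 6"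
    if abc: "b \<in> nbrs G a" "c \<in> nbrs G a" "c \<in> nbrs G b" for a b c
  proof -
    have sym: "a \<in> nbrs G b" "a \<in> nbrs G c" "b \<in> nbrs G c" using abc nbrs_sym by auto
    have "distinct [a, b, c]" using abc nbrs_irrefl by auto
    then show ?thesis
      using walks_3_triangle[OF abc] walks_3_triangle[of a b c] walks_3_triangle[of a c b] abc sym
      by simp
  qed
  have "{a, b, c} \<union> {x, y, z} \<subseteq> verts G" using abc xyz nbrs_verts by blast
  then have "(\<Sum>v\<in>{a, b, c} \<union> {x, y, z}. walks G (Suc (Suc (Suc 0))) v v) < 12"
    using closed_walks_ge assms(1) by (blast intro: order_le_less_trans)
  then show False
    using tri[OF abc] tri[OF xyz] disj by (subst (asm) sum.union_disjoint) auto
qed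

text \<open>The trace bound leaves at most 10 closed walks of length 3, too few for a second
  triangle besides \<open>a\<close>, \<open>b\<close>, \<open>c\<close>. This determines the whole
  graph, which is then refuted.\<close>

lemma card_8_triangle_free:
  assumes mu: "mu 1 G \<le> 1" and card: "card (verts G) = 8"
    and tri: "b \<in> nbrs G a" "c \<in> nbrs G a" "c \<in> nbrs G b"
  shows False
proof -
  have few: "closed_walks (Suc (Suc (Suc 0))) < 12" using closed_walks_3_le[OF mu] card by simp
  note uniq = common_nbr_unique[OF few]
  have abc: "distinct [a, b, c]" using tri nbrs_irrefl by auto
  have sym: "a \<in> nbrs G b" "a \<in> nbrs G c" "b \<in> nbrs G c" using tri nbrs_sym by auto
  obtain a' where a': "nbrs G a = {b, c, a'}"
    using obtain_third_nbr tri abc by (metis distinct_length_2_or_more)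
  obtain b' where b': "nbrs G b = {a, c, b'}"
    using obtain_third_nbr tri sym abc by (metis distinct_length_2_or_more)
  obtain c' where c': "nbrs G c = {a, b, c'}"
    using obtain_third_nbr tri sym abc by (metis distinct_length_2_or_more)
  note d = nbrs_distinct[OF a'] nbrs_distinct[OF b'] nbrs_distinct[OF c']
  have "a' \<noteq> b'" using uniq[of b a c a'] a' b' d by auto
  moreover have "a' \<noteq> c'" using uniq[of c a b a'] a' c' d by auto
  moreover have "b' \<noteq> c'" using uniq[of c b a b'] b' c' d by auto
  ultimately have dist: "distinct [a, b, c, a', b', c']" using d by auto
  let ?S = "{a, b, c, a', b', c'}"
  have sub: "?S \<subseteq> verts G"
    using a' b' c' nbrs_verts(1)[OF tri(1)] nbrs_verts(2)[of _ a] nbrs_verts(2)[of _ b] nbrs_verts(2)[of _ c]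
    by auto
  moreover have "card ?S = 6" using distinct_card[OF dist] by simp
  ultimately have "card (verts G - ?S) = 2" using card by (simp add: card_Diff_subset)
  then obtain u w where uw: "verts G - ?S = {u, w}" "u \<noteq> w" by (auto simp: card_2_iff)
  then have verts: "verts G = {a, b, c, a', b', c', u, w}" using sub by blast
  have dist: "distinct [a, b, c, a', b', c', u, w]" using dist uw by auto
  have "nbrs G x \<subseteq> {a, b, c, a', b', c', u, w} - {x}" for x
    using verts nbrs_verts(2) nbrs_irrefl by blast
  then have u_sub: "nbrs G u \<subseteq> {a', b', c', w}" and w_sub: "nbrs G w \<subseteq> {a', b', c', u}"
    using a' b' c' dist nbrs_sym[of a u] nbrs_sym[of b u] nbrs_sym[of c u]
      nbrs_sym[of a w] nbrs_sym[of b w] nbrs_sym[of c w] by auto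
  \<comment> \<open>If adjacent, \<open>u\<close> and \<open>w\<close> would each have two
    neighbours among \<open>a'\<close>, \<open>b'\<close>, \<open>c'\<close> and so share one,
    giving a triangle disjoint from the first.\<close>
  have uw': "w \<notin> nbrs G u"
  proof
    assume w: "w \<in> nbrs G u"
    then have u: "u \<in> nbrs G w" using nbrs_sym by blast
    obtain p q where p: "nbrs G u = {w, p, q}" using obtain_other_nbrs[OF w] .
    obtain r s where r: "nbrs G w = {u, r, s}" using obtain_other_nbrs[OF u] .
    have "distinct [u, w, p, q]" "distinct [w, u, r, s]"
      using nbrs_distinct[OF p] nbrs_distinct[OF r] .
    then have "{p, q} \<subseteq> {a', b', c'}" "{r, s} \<subseteq> {a', b', c'}" "p \<noteq> q" "r \<noteq> s"
      using u_sub w_sub p r by auto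
    then have "card ({p, q} \<union> {r, s}) \<le> card {a', b', c'}" "card {p, q} = 2" "card {r, s} = 2"
      by (auto intro!: card_mono)
    then have "{p, q} \<inter> {r, s} \<noteq> {}"
      using card_Un_disjoint[of "{p, q}" "{r, s}"] card_length[of "[a', b', c']"] by auto
    then obtain z where z: "z \<in> nbrs G u" "z \<in> nbrs G w" using p r by auto
    then have "{a, b, c} \<inter> {u, w, z} \<noteq> {}"
      using triangles_not_disjoint[OF few tri w] by blast
    moreover have "z \<in> {a', b', c'}" using z u_sub w_sub nbrs_irrefl by blast
    ultimately show False using dist by auto
  qed
  then have "u \<notin> nbrs G w" using nbrs_sym by blast
  then have nu: "nbrs G u = {a', b', c'}" and nw: "nbrs G w = {a', b', c'}"
    using u_sub w_sub uw' verts by (auto intro!: nbrs_eqI)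
  have na': "nbrs G a' = {a, u, w}" and nb': "nbrs G b' = {b, u, w}" and nc': "nbrs G c' = {c, u, w}"
  proof -
    have "a \<in> nbrs G a'" "u \<in> nbrs G a'" "w \<in> nbrs G a'" "b \<in> nbrs G b'" "u \<in> nbrs G b'"
      "w \<in> nbrs G b'" "c \<in> nbrs G c'" "u \<in> nbrs G c'" "w \<in> nbrs G c'"
      by (simp_all add: nbrs_sym[of a a'] nbrs_sym[of b b'] nbrs_sym[of c c'] nbrs_sym[of u a']
        nbrs_sym[of u b'] nbrs_sym[of u c'] nbrs_sym[of w a'] nbrs_sym[of w b'] nbrs_sym[of w c']
        a' b' c' nu nw)
    moreover have "distinct [a, u, w]" "distinct [b, u, w]" "distinct [c, u, w]" using dist by auto
    ultimately show "nbrs G a' = {a, u, w}" "nbrs G b' = {b, u, w}" "nbrs G c' = {c, u, w}"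
      using nbrs_eqI' by blast+
  qed
  text \<open>The graph is now known: it is \<open>K\<^bsub>3,3\<^esub>\<close> with one vertex replaced by a triangle.
    The quotient of its adjacency matrix by the partition \<open>{a, b, c}\<close>, \<open>{a', b', c'}\<close>,
    \<open>{u, w}\<close> has characteristic polynomial \<open>(X - 3) (X\<^sup>2 + X - 4)\<close>.\<close>
  define l :: real where "l = (sqrt 17 - 1) / 2"
  have l2: "l * l = 4 - l" by (simp add: l_def field_simps)
  have "sqrt 17 > 3" by (rule real_less_rsqrt) simp
  moreover have "sqrt 17 < 5" by (rule real_less_lsqrt) simp_all
  ultimately have l: "l > 1" "l < 3" by (auto simp: l_def)
  \<comment> \<open>An eigenvector constant on the three classes: the value 3 on
    \<open>{u, w}\<close> forces \<open>l\<close> on \<open>a'\<close>, \<open>b'\<close>,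
    \<open>c'\<close>, and the equation at \<open>a'\<close> then forces
    \<open>l * l - 6 = - 2 - l\<close> on the triangle.\<close>
  define x where "x v = (if v \<in> {a, b, c} then - 2 - l else if v \<in> {u, w} then 3 else l)" for v
  have x: "x a = - 2 - l" "x b = - 2 - l" "x c = - 2 - l" "x a' = l" "x b' = l" "x c' = l" "x u = 3" "x w = 3"
    using dist by (auto simp: x_def)
  have "l \<in># spectrum G"
    unfolding spectrum_iff_eigenvector
  proof (intro exI[of _ x] conjI)
    show "\<exists>v\<in>verts G. x v \<noteq> 0" using x(7) verts by (intro bexI[of _ u]) auto
    have "distinct [w, u, c', b', a', c, b, a]" using dist by auto
    then show "\<forall>v\<in>verts G. sum x (nbrs G v) = l * x v"
      using dist by (simp add: verts a' b' c' nu nw na' nb' nc' x algebra_simps l2)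
  qed
  then have "mu 1 G > 1" using three_in_spectrum l by (intro mu_1_gt[of l 3]) auto
  then show False using mu by simp
qed

text \<open>At ten vertices both trace bounds meet the sums of the local lower bounds 0 and 15, so
  equality holds at every vertex.\<close>

lemma card_10_closed_walks:
  assumes mu: "mu 1 G \<le> 1" and card: "card (verts G) = 10" and v: "v \<in> verts G"
  shows "walks G (Suc (Suc (Suc 0))) v v = 0" and "walks G (Suc (Suc (Suc (Suc 0)))) v v = 15"
proof -
  have zero: "closed_walks (Suc (Suc (Suc 0))) = 0"
    using closed_walks_3_le[OF mu] closed_walks_3_nonneg card by simp
  then show "walks G (Suc (Suc (Suc 0))) v v = 0"
    using v by (simp add: sum_nonneg_eq_0_iff walks_nonneg)
  have ge: "15 \<le> walks G (Suc (Suc (Suc (Suc 0)))) u u" if "u \<in> verts G" for u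
    using walks_add_2_ge[of "Suc 0" u u] walks_2_self[OF that] by simp
  have "closed_walks (Suc (Suc (Suc (Suc 0)))) \<le> 150"
    using closed_walks_4_le[OF mu] zero card by simp
  moreover have "(\<Sum>u\<in>verts G. 15) \<le> closed_walks (Suc (Suc (Suc (Suc 0))))"
    using ge by (intro sum_mono)
  ultimately have "(\<Sum>u\<in>verts G. 15) = closed_walks (Suc (Suc (Suc (Suc 0))))"
    using card by simp
  then show "walks G (Suc (Suc (Suc (Suc 0)))) v v = 15"
    using sum_mono_inv[of "\<lambda>_. 15" "verts G" "\<lambda>u. walks G (Suc (Suc (Suc (Suc 0)))) u u" v] ge v by simp
qed

lemma card_10_triangle_free:
  assumes "mu 1 G \<le> 1" "card (verts G) = 10" "y \<in> nbrs G x" "z \<in> nbrs G x"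
  shows "z \<notin> nbrs G y"
  using walks_3_triangle[OF assms(3,4)] card_10_closed_walks(1)[OF assms(1,2)] nbrs_verts(1)[OF assms(3)]
  by fastforce

text \<open>Equality is passed down from length 4 to length 2. The 15 closed walks at
  \<open>x\<close> are three terms of at least 5, so each is 5; each of these is 3 + 1 + 1 at least,
  so there is one walk of length 2 from \<open>x\<close> to \<open>w\<close>, whereas
  \<open>y\<close> and \<open>z\<close> would give two.\<close>

lemma card_10_common_nbr_unique:
  assumes mu: "mu 1 G \<le> 1" "card (verts G) = 10"
    and yz: "y \<in> nbrs G x" "z \<in> nbrs G x" "y \<in> nbrs G w" "z \<in> nbrs G w" "y \<noteq> z"
  shows "x = w"
proof (rule ccontr)
  assume "x \<noteq> w"
  have verts: "x \<in> verts G" "y \<in> verts G" using yz nbrs_verts by auto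
  have x: "x \<in> nbrs G y" and w: "w \<in> nbrs G y" using yz nbrs_sym by auto
  have "(\<Sum>u\<in>nbrs G x. 5) = (\<Sum>u\<in>nbrs G x. walks G (Suc (Suc (Suc 0))) x u)"
    using card_10_closed_walks(2)[OF mu verts(1)] card_nbrs[OF verts(1)]
    by (subst (asm) walks_Suc) simp
  moreover have "5 \<le> walks G (Suc (Suc (Suc 0))) x u" if "u \<in> nbrs G x" for u
    using walks_3_ge that nbrs_sym by blast
  ultimately have "walks G (Suc (Suc (Suc 0))) x y = 5"
    using sum_mono_inv[of "\<lambda>_. 5" "nbrs G x" "walks G (Suc (Suc (Suc 0))) x" y] yz finite_nbrs by simp
  then have "walks G (Suc (Suc 0)) x x + (\<Sum>t\<in>nbrs G y - {x}. walks G (Suc (Suc 0)) x t) = 5"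
    using x finite_nbrs by (subst (asm) walks_Suc) (simp add: sum.remove)
  then have sum2: "(\<Sum>t\<in>nbrs G y - {x}. walks G (Suc (Suc 0)) x t) = 2"
    using walks_2_self[OF verts(1)] by simp
  have "card (nbrs G y - {x}) = 2" using x card_nbrs[OF verts(2)] finite_nbrs by simp
  then have "(\<Sum>t\<in>nbrs G y - {x}. 1) = (\<Sum>t\<in>nbrs G y - {x}. walks G (Suc (Suc 0)) x t)"
    using sum2 by simp
  moreover have "1 \<le> walks G (Suc (Suc 0)) x t" if "t \<in> nbrs G y - {x}" for t
    using walks_2_ge_1[of x y t] x that by simp
  ultimately have "walks G (Suc (Suc 0)) x w = 1"
    using sum_mono_inv[of "\<lambda>_. 1" "nbrs G y - {x}" "walks G (Suc (Suc 0)) x" w] w \<open>x \<noteq> w\<close> finite_nbrs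
    by simp
  moreover have "2 \<le> real (card (nbrs G x \<inter> nbrs G w))"
    using card_common_nbrs_ge[of "[y, z]" x w] yz by simp
  ultimately show False by (simp add: walks_2)
qed

lemma mu_1_le_1_labelling:
  assumes mu: "mu 1 G \<le> 1"
  shows "\<exists>nb\<in>{K4_nbrs, K33_nbrs, prism_nbrs, cube_nbrs, wagner_nbrs, petersen_nbrs}. \<exists>vs. labelling G nb vs"
proof -
  have "card (verts G) \<le> 10" using closed_walks_3_le[OF mu] closed_walks_3_nonneg by simp
  then consider "card (verts G) = 4" | "card (verts G) = 6" | "card (verts G) = 8" | "card (verts G) = 10"
    using card_verts_ge_4 even_card_verts by (auto dest: even_le_10)
  then show ?thesis
  proof cases
    case 1
    then show ?thesis using card_4_labelling by blast
  next
    case 2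
    then show ?thesis using card_6_triangle card_6_triangle_free by blast
  next
    case 3
    interpret triangle_free_cubic
      by unfold_locales (use card_8_triangle_free[OF mu 3] in blast)
    show ?thesis using card_8_labelling[OF 3] by blast
  next
    case 4
    interpret triangle_free_cubic
      by unfold_locales (rule card_10_triangle_free[OF mu 4])
    have "\<exists>vs. labelling G petersen_nbrs vs"
      by (rule card_10_labelling[OF 4]) (rule card_10_common_nbr_unique[OF mu 4])
    then show ?thesis by blast
  qed
qed

end

section \<open>From labellings to the classification by \<open>mu 1\<close>\<close>

lemma connected_cubic_graph_imp_cubic:
  assumes "connected_cubic_graph G" shows "cubic G"
proof -
  have reg: "graph G" "\<forall>v\<in>verts G. out_degree G v = 3" and con: "connected G"
    using assms by (auto simp: connected_cubic_graph_def regular_graph_def)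
  interpret graph G by fact
  show ?thesis
  proof
    show "card (nbrs G v) = 3" if "v \<in> verts G" for v
      using reg(2) that by (simp add: out_degree_eq_card_nbrs)
    show "verts G \<noteq> {}" using con by (auto simp: connected_def strongly_connected_def)
  qed
qed

lemma digraph_iso_card_verts:
  assumes "digraph_iso G H" shows "card (verts G) = card (verts H)"
proof -
  obtain f where "pre_digraph.digraph_isomorphism G f" "H = app_iso f G"
    using assms by (auto simp: digraph_iso_def)
  then have "inj_on (iso_verts f) (verts G)" "verts H = iso_verts f ` verts G"
    by (auto simp: pre_digraph.digraph_isomorphism_def)
  then show ?thesis by (simp add: card_image)
qed

lemma labelling_card_verts: "labelling G nb vs \<Longrightarrow> card (verts G) = length nb"
  by (metis distinct_card labelling_def)

text \<open>The cube is bipartite, whereas \<open>0, 1, 2, 3, 4\<close> is a closed walk of odd length in the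
  Wagner graph.\<close>

lemma not_digraph_iso_cube_wagner: "\<not> digraph_iso (with_proj cube_graph) (with_proj wagner_graph)"
proof
  assume "digraph_iso (with_proj cube_graph) (with_proj wagner_graph)"
  then obtain vs where vs: "labelling (with_proj cube_graph) wagner_nbrs vs"
    using digraph_iso_imp_labelling[OF _ wagner] by blast
  define odd_parity :: "bool list \<Rightarrow> bool" where "odd_parity xs = ((xs ! 0 \<noteq> xs ! 1) \<noteq> xs ! 2)" for xs
  have flip: "odd_parity xs \<noteq> odd_parity ys" if adj: "(xs, ys) \<in> parcs cube_graph" for xs ys
  proof -
    have "length xs = 3" "length ys = 3" using adj by (auto simp: cube_graph_def)
    then obtain a b c a' b' c' where xs: "xs = [a, b, c]" and ys: "ys = [a', b', c']"
      by (auto simp: length_Suc_conv numeral_3_eq_3)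
    then have "of_bool (a \<noteq> a') + of_bool (b \<noteq> b') + of_bool (c \<noteq> c') = (1 :: nat)"
      using adj unfolding xs ys hamming_distance_3[symmetric] by (simp add: cube_graph_def)
    then show ?thesis
      unfolding xs ys odd_parity_def by (auto simp: of_bool_def split: if_splits)
  qed
  have "odd_parity (vs ! i) \<noteq> odd_parity (vs ! j)"
    if "i < 8" "j < 8" "j \<in> set (wagner_nbrs ! i)" for i j
  proof -
    have "length wagner_nbrs = 8" by (simp add: wagner_nbrs_def)
    then show ?thesis
      using labelling_adjacent_iff[OF vs, of i j] that flip by simp
  qed
  from this[of 0 1] this[of 1 2] this[of 2 3] this[of 3 4] this[of 4 0]
  show False by (simp add: wagner_nbrs_def)
qed

theorem theorem1p3:
  fixes X :: "('a, 'b) pre_digraph"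
  shows
    "(connected_cubic_graph X \<and> mu 1 X \<le> 2 \<longrightarrow> card (verts X) \<le> 105)
   \<and> (connected_cubic_graph X \<and> mu 1 X \<le> 1 \<longrightarrow>
        digraph_iso X (with_proj (complete_graph 4)) \<or>
        digraph_iso X (with_proj (complete_bipartite_graph 3 3)) \<or>
        digraph_iso X (with_proj triangular_prism) \<or>
        digraph_iso X (with_proj cube_graph) \<or>
        digraph_iso X (with_proj wagner_graph) \<or>
        digraph_iso X (with_proj petersen_graph))
   \<and> (connected_cubic_graph X \<and> mu 1 X = 1 \<longleftrightarrow>
        digraph_iso X (with_proj triangular_prism) \<or>
        digraph_iso X (with_proj cube_graph) \<or>
        digraph_iso X (with_proj wagner_graph) \<or>
        digraph_iso X (with_proj petersen_graph))
   \<and> (\<not> digraph_iso (with_proj triangular_prism) (with_proj cube_graph) \<and>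
      \<not> digraph_iso (with_proj triangular_prism) (with_proj wagner_graph) \<and>
      \<not> digraph_iso (with_proj triangular_prism) (with_proj petersen_graph) \<and>
      \<not> digraph_iso (with_proj cube_graph) (with_proj wagner_graph) \<and>
      \<not> digraph_iso (with_proj cube_graph) (with_proj petersen_graph) \<and>
      \<not> digraph_iso (with_proj wagner_graph) (with_proj petersen_graph))
   \<and> (connected_cubic_graph X \<and> mu 1 X = 0 \<longleftrightarrow>
        digraph_iso X (with_proj (complete_bipartite_graph 3 3)))
   \<and> (connected_cubic_graph X \<and> mu 1 X = -1 \<longleftrightarrow>
        digraph_iso X (with_proj (complete_graph 4)))"
proof -
  have le_2: "card (verts X) \<le> 105" if "connected_cubic_graph X" "mu 1 X \<le> 2"
  proof -
    interpret cubic X using that(1) by (rule connected_cubic_graph_imp_cubic)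
    show ?thesis using card_le_37[OF that(2)] by simp
  qed
  have le_1: "digraph_iso X (with_proj (complete_graph 4)) \<or>
      digraph_iso X (with_proj (complete_bipartite_graph 3 3)) \<or>
      digraph_iso X (with_proj triangular_prism) \<or>
      digraph_iso X (with_proj cube_graph) \<or>
      digraph_iso X (with_proj wagner_graph) \<or>
      digraph_iso X (with_proj petersen_graph)"
    if "connected_cubic_graph X" "mu 1 X \<le> 1"
  proof -
    interpret cubic X using that(1) by (rule connected_cubic_graph_imp_cubic)
    note iso = labelling_imp_digraph_iso[OF graph_axioms]
    show ?thesis
      using mu_1_le_1_labelling[OF that(2)]
        iso[OF _ K4(2,1)] iso[OF _ K33(2,1)] iso[OF _ prism(2,1)] iso[OF _ cube(2,1)]
        iso[OF _ wagner(2,1)] iso[OF _ petersen(2,1)]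
      by blast
  qed
  note lab = digraph_iso_imp_labelling
  have K4': "connected_cubic_graph X \<and> mu 1 X = -1" if "digraph_iso X (with_proj (complete_graph 4))"
    using lab[OF that K4] mu_1_K4 by blast
  have K33': "connected_cubic_graph X \<and> mu 1 X = 0"
    if "digraph_iso X (with_proj (complete_bipartite_graph 3 3))"
    using lab[OF that K33] mu_1_K33 by blast
  have prism': "connected_cubic_graph X \<and> mu 1 X = 1" if "digraph_iso X (with_proj triangular_prism)"
    using lab[OF that prism] mu_1_prism by blast
  have cube': "connected_cubic_graph X \<and> mu 1 X = 1" if "digraph_iso X (with_proj cube_graph)"
    using lab[OF that cube] mu_1_cube by blast
  have wagner': "connected_cubic_graph X \<and> mu 1 X = 1" if "digraph_iso X (with_proj wagner_graph)"
    using lab[OF that wagner] mu_1_wagner by blast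
  have petersen': "connected_cubic_graph X \<and> mu 1 X = 1" if "digraph_iso X (with_proj petersen_graph)"
    using lab[OF that petersen] mu_1_petersen by blast
  have card: "card (verts (with_proj triangular_prism)) = 6" "card (verts (with_proj cube_graph)) = 8"
    "card (verts (with_proj wagner_graph)) = 8" "card (verts (with_proj petersen_graph)) = 10"
    unfolding labelling_card_verts[OF prism(2)] labelling_card_verts[OF cube(2)]
      labelling_card_verts[OF wagner(2)] labelling_card_verts[OF petersen(2)]
    by (simp_all add: prism_nbrs_def cube_nbrs_def wagner_nbrs_def petersen_nbrs_def)
  \<comment> \<open>The vertex counts 6, 8, 8, 10 separate all pairs except the cube and the Wagner
    graph.\<close>
  have neq: "\<not> digraph_iso (with_proj triangular_prism) (with_proj cube_graph)"
    "\<not> digraph_iso (with_proj triangular_prism) (with_proj wagner_graph)"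
    "\<not> digraph_iso (with_proj triangular_prism) (with_proj petersen_graph)"
    "\<not> digraph_iso (with_proj cube_graph) (with_proj petersen_graph)"
    "\<not> digraph_iso (with_proj wagner_graph) (with_proj petersen_graph)"
    using card by (auto dest!: digraph_iso_card_verts)
  have eq_1: "connected_cubic_graph X \<and> mu 1 X = 1 \<longleftrightarrow>
      digraph_iso X (with_proj triangular_prism) \<or> digraph_iso X (with_proj cube_graph) \<or>
      digraph_iso X (with_proj wagner_graph) \<or> digraph_iso X (with_proj petersen_graph)"
    (is "?C \<and> _ \<longleftrightarrow> ?R")
  proof
    assume C: "?C \<and> mu 1 X = 1"
    then have "digraph_iso X (with_proj (complete_graph 4)) \<or>
        digraph_iso X (with_proj (complete_bipartite_graph 3 3)) \<or>
        digraph_iso X (with_proj triangular_prism) \<or>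
        digraph_iso X (with_proj cube_graph) \<or>
        digraph_iso X (with_proj wagner_graph) \<or>
        digraph_iso X (with_proj petersen_graph)"
      using le_1 by simp
    then show ?R
      \<comment> \<open>A candidate outside the claimed list is excluded because its computed
        \<open>mu 1\<close> differs from the assumed value.\<close>
      by (elim disjE) (use C K4' K33' prism' cube' wagner' petersen' in simp_all)
  qed (use K4' K33' prism' cube' wagner' petersen' in blast)
  have eq_0: "connected_cubic_graph X \<and> mu 1 X = 0 \<longleftrightarrow>
      digraph_iso X (with_proj (complete_bipartite_graph 3 3))"
    (is "?C \<and> _ \<longleftrightarrow> ?R")
  proof
    assume C: "?C \<and> mu 1 X = 0"
    then have "digraph_iso X (with_proj (complete_graph 4)) \<or>
        digraph_iso X (with_proj (complete_bipartite_graph 3 3)) \<or>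
        digraph_iso X (with_proj triangular_prism) \<or>
        digraph_iso X (with_proj cube_graph) \<or>
        digraph_iso X (with_proj wagner_graph) \<or>
        digraph_iso X (with_proj petersen_graph)"
      using le_1 by simp
    then show ?R
      by (elim disjE) (use C K4' K33' prism' cube' wagner' petersen' in simp_all)
  qed (use K4' K33' prism' cube' wagner' petersen' in blast)
  have eq_m1: "connected_cubic_graph X \<and> mu 1 X = -1 \<longleftrightarrow>
      digraph_iso X (with_proj (complete_graph 4))"
    (is "?C \<and> _ \<longleftrightarrow> ?R")
  proof
    assume C: "?C \<and> mu 1 X = -1"
    then have "digraph_iso X (with_proj (complete_graph 4)) \<or>
        digraph_iso X (with_proj (complete_bipartite_graph 3 3)) \<or>
        digraph_iso X (with_proj triangular_prism) \<or>
        digraph_iso X (with_proj cube_graph) \<or>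
        digraph_iso X (with_proj wagner_graph) \<or>
        digraph_iso X (with_proj petersen_graph)"
      using le_1 by simp
    then show ?R
      by (elim disjE) (use C K4' K33' prism' cube' wagner' petersen' in simp_all)
  qed (use K4' K33' prism' cube' wagner' petersen' in blast)
  show ?thesis
    using le_2 le_1 eq_1 eq_0 eq_m1 neq not_digraph_iso_cube_wagner by blast
qed

end
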